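(* Let $T=[0,1]^d$, let $I$ be a countable set, and let $(a_j)_{j\in I}$ be real numbers with $\sum_{j\in I}|a_j|<\infty$. Let $U_j^{(n)}=U_j^{(n)}(t)$, $t\in T$, $j\in I$, $n=1,2,\dots$, be stochastic processes such that $$\sup_n\sup_{j\in I}\mathbb{E}\big(\|U_j^{(n)}\|_T\big)<\infty ,$$ and let $\psi^{(n)}=\psi^{(n)}(t)$, $t\in T$, $n=1,2,\dots$, be stochastic processes that admit the representation $$\psi^{(n)}=\sum_{j\in I}a_jU_j^{(n)} .$$ Let $I=\bigcup_m I_m$ for some increasing sequence of subsets $I_m$ of $I$, and assume that for each $m$, $$\sum_{j\in I_m}a_jU_j^{(n)}\Longrightarrow Z_m\quad\text{as } n\to\infty$$ in $C[0,1]^d$ (or in $D[0,1]^d$ endowed with the uniform norm), where $Z_m$ is a continuous stochastic process. Then there exists a stochastic process $Z$ with sample paths in $C[0,1]^d$ such that $Z_m\Longrightarrow Z$ in $C[0,1]^d$ as $m\to\infty$, and $\psi^{(n)}\Longrightarrow Z$ as $n\to\infty$ in $C[0,1]^d$ (respectively, in $D[0,1]^d$ endowed with the uniform norm).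
   Context: $\|x\|_T=\sup_{t\in T}|x(t)|$, and $\Longrightarrow$ denotes weak convergence. $C[0,1]^d$ is the space of continuous real functions on $[0,1]^d$ and $D[0,1]^d$ is the space of cadlag functions on $[0,1]^d$; both carry the uniform norm. The processes $U_j^{(n)}$ and $\psi^{(n)}$ have sample paths in $C[0,1]^d$ (respectively $D[0,1]^d$), and for each $n$ they are defined on a common probability space. *)

theory Defs
  imports "HOL-Probability.Probability"
begin

type_synonym 'd path = "real^'d \<Rightarrow> real"

abbreviation cube :: "(real^'d) set" where
  "cube \<equiv> cbox 0 1"

text \<open>Paths are functions on the cube; as usual for sets of functions with a prescribed
  domain, they are taken to be \<open>extensional\<close>, so that equality of paths is equality on the cube.\<close>

definition C_paths :: "('d::finite) path set" where
  "C_paths = {x \<in> extensional cube. continuous_on cube x}"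

text \<open>For a set \<open>A\<close> of coordinates, \<open>quadrant A t\<close> consists of the points of the cube that lie
  strictly below \<open>t\<close> in the coordinates from \<open>A\<close> and weakly above \<open>t\<close> in the others.
  A function is cadlag if it is continuous from above and has limits in all quadrants.
  For \<open>d = 1\<close> these are the right-continuous functions on \<open>[0,1]\<close> with left limits.
  Where \<open>t\<close> is not a limit point of a quadrant, the corresponding condition is void.\<close>

definition quadrant :: "'d set \<Rightarrow> real^'d \<Rightarrow> (real^'d::finite) set" where
  "quadrant A t = {s \<in> cube. \<forall>i. if i \<in> A then s $ i < t $ i else t $ i \<le> s $ i}"

definition cadlag :: "('d::finite) path \<Rightarrow> bool" where
  "cadlag x \<longleftrightarrow> (\<forall>t\<in>cube.
     (x \<longlongrightarrow> x t) (at t within quadrant {} t) \<and>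
     (\<forall>A. \<exists>l. (x \<longlongrightarrow> l) (at t within quadrant A t)))"

definition D_paths :: "('d::finite) path set" where
  "D_paths = {x \<in> extensional cube. cadlag x}"

definition sup_norm :: "('d::finite) path \<Rightarrow> ennreal" where
  "sup_norm x = (SUP t\<in>cube. ennreal \<bar>x t\<bar>)"

text \<open>On \<open>C_paths\<close> and \<open>D_paths\<close> the supremum is finite, so the conversion to a real number is
  harmless there; see \<open>Metric_space_D_paths\<close> and \<open>sup_dist_eq\<close> below.\<close>

definition sup_dist :: "('d::finite) path \<Rightarrow> 'd path \<Rightarrow> real" where
  "sup_dist x y = enn2real (sup_norm (\<lambda>t. x t - y t))"

text \<open>A set of paths carries the \<open>\<sigma>\<close>-algebra generated by the evaluations at the points of the
  cube. Thus \<open>X \<in> P \<rightarrow>\<^sub>M path_space S\<close> says that \<open>X\<close> is a stochastic process on \<open>P\<close> all of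
  whose sample paths belong to \<open>S\<close>; see \<open>measurable_path_space_iff\<close> below.\<close>

definition path_space :: "('d::finite) path set \<Rightarrow> 'd path measure" where
  "path_space S = restrict_space (Pi\<^sub>M cube (\<lambda>_. borel)) S"

text \<open>Weak convergence of the processes \<open>X n\<close> on \<open>P n\<close> to the process \<open>Y\<close> on \<open>Q\<close>, in the set
  \<open>S\<close> of paths with the uniform norm. Since \<open>D_paths\<close> is not separable, its Borel sets are too
  many for processes to be Borel measurable, and the test functionals are, as usual, required to
  be measurable for the \<open>\<sigma>\<close>-algebra of the evaluations. On \<open>C_paths\<close> that
  requirement is redundant, see \<open>weakly_converges_C_paths_iff\<close> below.\<close>

definition weakly_converges ::
  "('d::finite) path set \<Rightarrow> (nat \<Rightarrow> 'w measure) \<Rightarrow> (nat \<Rightarrow> 'w \<Rightarrow> 'd path) \<Rightarrow>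
   'v measure \<Rightarrow> ('v \<Rightarrow> 'd path) \<Rightarrow> bool" where
  "weakly_converges S P X Q Y \<longleftrightarrow>
     (\<forall>f :: 'd path \<Rightarrow> real.
        continuous_map (Metric_space.mtopology S sup_dist) euclideanreal f \<longrightarrow>
        bounded (f ` S) \<longrightarrow>
        f \<in> borel_measurable (path_space S) \<longrightarrow>
        (\<lambda>n. \<integral>\<omega>. f (X n \<omega>) \<partial>P n) \<longlonglongrightarrow> (\<integral>\<omega>. f (Y \<omega>) \<partial>Q))"

text \<open>\<open>X = (\<Sum>j\<in>J. a j * U j)\<close>, almost surely as functions on the cube. The series need not
  converge outside a null set, so that \<open>X\<close> is determined up to indistinguishability.\<close>

definition represents ::
  "'w measure \<Rightarrow> 'i set \<Rightarrow> ('i \<Rightarrow> real) \<Rightarrow> ('i \<Rightarrow> 'w \<Rightarrow> ('d::finite) path) \<Rightarrow>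
   ('w \<Rightarrow> 'd path) \<Rightarrow> bool" where
  "represents P J a U X \<longleftrightarrow>
     (AE \<omega> in P. \<forall>t\<in>cube. ((\<lambda>j. a j * U j \<omega> t) has_sum X \<omega> t) J)"


lemma cube_nonempty [simp]: "(cube :: (real^'d) set) \<noteq> {}"
  by (auto simp: box_ne_empty inner_axis_axis Basis_vec_def inner_axis)

lemma measurable_path_space_iff:
  assumes "S \<subseteq> extensional cube"
  shows "X \<in> P \<rightarrow>\<^sub>M path_space S \<longleftrightarrow>
    (\<forall>\<omega>\<in>space P. X \<omega> \<in> S) \<and> (\<forall>t\<in>cube. (\<lambda>\<omega>. X \<omega> t) \<in> borel_measurable P)"
    (is "?L \<longleftrightarrow> ?R")
proof
  assume L: ?L
  then have X: "X \<in> space P \<rightarrow> S" "X \<in> P \<rightarrow>\<^sub>M Pi\<^sub>M cube (\<lambda>_. borel)"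
    by (auto simp: path_space_def measurable_restrict_space2_iff)
  have "(\<lambda>\<omega>. X \<omega> t) \<in> borel_measurable P" if "t \<in> cube" for t
    using measurable_compose[OF X(2) measurable_component_singleton[OF that]] by simp
  with X show ?R by auto
next
  assume R: ?R
  have "X \<in> P \<rightarrow>\<^sub>M Pi\<^sub>M cube (\<lambda>_. borel)"
  proof (rule measurable_PiM_single')
    show "X \<in> space P \<rightarrow> cube \<rightarrow>\<^sub>E space borel"
      using R assms by (auto simp: PiE_def)
  qed (use R in auto)
  with R show ?L by (auto simp: path_space_def measurable_restrict_space2_iff)
qed

lemma sup_norm_less_top_iff: "sup_norm x < \<top> \<longleftrightarrow> bounded (x ` cube)"
proof
  assume "sup_norm x < \<top>"
  then obtain b where b: "0 \<le> b" "sup_norm x = ennreal b"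
    by (cases "sup_norm x") auto
  have "\<bar>x t\<bar> \<le> b" if "t \<in> cube" for t
  proof -
    have "ennreal \<bar>x t\<bar> \<le> ennreal b"
      unfolding b(2)[symmetric] sup_norm_def by (rule SUP_upper[OF that])
    then show ?thesis using b by simp
  qed
  then show "bounded (x ` cube)"
    by (auto simp: bounded_iff)
next
  assume "bounded (x ` cube)"
  then obtain b where b: "\<And>t. t \<in> cube \<Longrightarrow> \<bar>x t\<bar> \<le> b"
    by (auto simp: bounded_iff)
  have "sup_norm x \<le> ennreal b"
    unfolding sup_norm_def by (rule SUP_least) (use b in \<open>auto intro: ennreal_leI\<close>)
  then show "sup_norm x < \<top>"
    using ennreal_less_top le_less_trans by blast
qed

lemma cadlag_bounded:
  fixes x :: "('d::finite) path"
  assumes "cadlag x"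
  shows "bounded (x ` cube)"
proof -
  have loc: "\<exists>U. open U \<and> t \<in> U \<and> bounded (x ` (U \<inter> cube))" if t: "t \<in> cube" for t
  proof -
    have "\<exists>U. open U \<and> t \<in> U \<and> bounded (x ` (U \<inter> quadrant A t))" for A
    proof -
      obtain l where "(x \<longlongrightarrow> l) (at t within quadrant A t)"
        using assms t unfolding cadlag_def by blast
      then have "eventually (\<lambda>s. dist (x s) l < 1) (at t within quadrant A t)"
        by (rule tendstoD) simp
      then obtain U where U: "open U" "t \<in> U"
        and s: "\<And>s. s \<in> U \<Longrightarrow> s \<noteq> t \<Longrightarrow> s \<in> quadrant A t \<Longrightarrow> dist (x s) l < 1"
        unfolding eventually_at_topological by blast
      have "x ` (U \<inter> quadrant A t) \<subseteq> insert (x t) (ball l 1)"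
      proof (intro subsetI, elim imageE)
        fix y s assume "y = x s" "s \<in> U \<inter> quadrant A t"
        then show "y \<in> insert (x t) (ball l 1)"
          using s[of s] by (cases "s = t") (auto simp: dist_commute)
      qed
      then have "bounded (x ` (U \<inter> quadrant A t))"
        by (rule bounded_subset[rotated]) simp
      with U show ?thesis by blast
    qed
    then obtain U where U: "\<And>A. open (U A)" "\<And>A. t \<in> U A"
      "\<And>A. bounded (x ` (U A \<inter> quadrant A t))" by metis
    have "s \<in> quadrant {i. s $ i < t $ i} t" if "s \<in> cube" for s
      using that by (auto simp: quadrant_def)
    then have "x ` ((\<Inter>A. U A) \<inter> cube) \<subseteq> (\<Union>A. x ` (U A \<inter> quadrant A t))"
      by blast
    moreover have "bounded (\<Union>A. x ` (U A \<inter> quadrant A t))"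
      using U(3) by (intro bounded_UN) auto
    ultimately have "bounded (x ` ((\<Inter>A. U A) \<inter> cube))"
      by (rule bounded_subset[rotated])
    moreover have "open (\<Inter>A. U A)"
      using U(1) by (intro open_INT) auto
    ultimately show ?thesis using U(2) by (intro exI[of _ "\<Inter>A. U A"]) auto
  qed
  then obtain U where U: "\<And>t. t \<in> cube \<Longrightarrow> open (U t)" "\<And>t. t \<in> cube \<Longrightarrow> t \<in> U t"
    "\<And>t. t \<in> cube \<Longrightarrow> bounded (x ` (U t \<inter> cube))" by metis
  have "compact (cube :: (real^'d) set)" by simp
  then obtain F where F: "F \<subseteq> cube" "finite F" "cube \<subseteq> (\<Union>t\<in>F. U t)"
    by (rule compactE_image[where C = cube and f = U]) (use U in auto)
  have "x ` cube \<subseteq> (\<Union>t\<in>F. x ` (U t \<inter> cube))"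
    using F(3) by blast
  moreover have "bounded (\<Union>t\<in>F. x ` (U t \<inter> cube))"
    using U(3) F by (intro bounded_UN) auto
  ultimately show ?thesis by (rule bounded_subset[rotated])
qed

lemma C_paths_subset_D_paths: "C_paths \<subseteq> D_paths"
proof -
  have "cadlag x" if "continuous_on cube x" for x :: "('d::finite) path"
    unfolding cadlag_def
  proof (intro ballI conjI allI)
    fix t :: "real^'d" and A :: "'d set"
    assume "t \<in> cube"
    with that have *: "(x \<longlongrightarrow> x t) (at t within cube)"
      by (auto simp: continuous_on_def)
    have "(x \<longlongrightarrow> x t) (at t within quadrant B t)" for B
      by (rule tendsto_within_subset[OF *]) (auto simp: quadrant_def)
    then show "(x \<longlongrightarrow> x t) (at t within quadrant {} t)"
      and "\<exists>l. (x \<longlongrightarrow> l) (at t within quadrant A t)" by blast+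
  qed
  then show ?thesis by (auto simp: C_paths_def D_paths_def)
qed

lemma D_paths_bounded: "x \<in> D_paths \<Longrightarrow> bounded (x ` cube)"
  by (simp add: D_paths_def cadlag_bounded)

lemma bounded_image_diff:
  fixes x y :: "('d::finite) path"
  assumes "bounded (x ` cube)" "bounded (y ` cube)"
  shows "bounded ((\<lambda>t. x t - y t) ` cube)"
  using bounded_minus_comp[OF assms] .

lemma sup_dist_le_iff:
  assumes "x \<in> D_paths" "y \<in> D_paths"
  shows "sup_dist x y \<le> b \<longleftrightarrow> (\<forall>t\<in>cube. \<bar>x t - y t\<bar> \<le> b)"
proof -
  have fin: "sup_norm (\<lambda>t. x t - y t) < \<top>"
    unfolding sup_norm_less_top_iff using assms D_paths_bounded by (blast intro: bounded_image_diff)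
  show ?thesis
  proof (cases "0 \<le> b")
    case True
    have "sup_dist x y \<le> b \<longleftrightarrow> sup_norm (\<lambda>t. x t - y t) \<le> ennreal b"
      unfolding sup_dist_def using fin True
      by (metis enn2real_leI ennreal_enn2real ennreal_leI)
    also have "\<dots> \<longleftrightarrow> (\<forall>t\<in>cube. \<bar>x t - y t\<bar> \<le> b)"
      unfolding sup_norm_def using True by (auto simp: SUP_le_iff)
    finally show ?thesis .
  next
    case False
    obtain t :: "real^'a" where "t \<in> cube" using cube_nonempty by blast
    then have "\<not> (\<forall>t\<in>cube. \<bar>x t - y t\<bar> \<le> b)" using False by force
    moreover have "0 \<le> sup_dist x y" by (simp add: sup_dist_def)
    ultimately show ?thesis using False by auto
  qed
qed

lemma sup_dist_eq:
  assumes "x \<in> D_paths" "y \<in> D_paths"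
  shows "sup_dist x y = (SUP t\<in>cube. \<bar>x t - y t\<bar>)"
proof (rule antisym)
  have bdd: "bdd_above ((\<lambda>t. \<bar>x t - y t\<bar>) ` cube)"
    using sup_dist_le_iff[OF assms, of "sup_dist x y"] by (auto simp: bdd_above_def)
  show "sup_dist x y \<le> (SUP t\<in>cube. \<bar>x t - y t\<bar>)"
    unfolding sup_dist_le_iff[OF assms] using cSUP_upper[OF _ bdd] by blast
  show "(SUP t\<in>cube. \<bar>x t - y t\<bar>) \<le> sup_dist x y"
    using sup_dist_le_iff[OF assms, of "sup_dist x y"] by (intro cSUP_least) auto
qed

lemma Metric_space_D_paths: "Metric_space (D_paths :: ('d::finite) path set) sup_dist"
proof
  fix x y z :: "'d path"
  show "0 \<le> sup_dist x y" by (simp add: sup_dist_def)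
  show "sup_dist x y = sup_dist y x"
    by (simp add: sup_dist_def sup_norm_def abs_minus_commute)
  assume D: "x \<in> D_paths" "y \<in> D_paths"
  have "sup_dist x y = 0 \<longleftrightarrow> sup_dist x y \<le> 0"
    using enn2real_nonneg[of "sup_norm (\<lambda>t. x t - y t)"] unfolding sup_dist_def by linarith
  also have "\<dots> \<longleftrightarrow> (\<forall>t\<in>cube. x t = y t)"
    unfolding sup_dist_le_iff[OF D] by auto
  also have "\<dots> \<longleftrightarrow> x = y"
    using D by (auto simp: D_paths_def intro: extensionalityI)
  finally show "sup_dist x y = 0 \<longleftrightarrow> x = y" .
  assume z: "z \<in> D_paths"
  have "\<bar>x t - z t\<bar> \<le> sup_dist x y + sup_dist y z" if "t \<in> cube" for t
  proof -
    have "\<bar>x t - y t\<bar> \<le> sup_dist x y" "\<bar>y t - z t\<bar> \<le> sup_dist y z"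
      using that sup_dist_le_iff[OF D, of "sup_dist x y"]
        sup_dist_le_iff[OF D(2) z, of "sup_dist y z"] by auto
    then show ?thesis by linarith
  qed
  then show "sup_dist x z \<le> sup_dist x y + sup_dist y z"
    unfolding sup_dist_le_iff[OF D(1) z] by blast
qed

lemma Metric_space_C_paths: "Metric_space C_paths sup_dist"
  using Metric_space.subspace[OF Metric_space_D_paths C_paths_subset_D_paths] .

lemma finite_net_cube:
  assumes "0 < \<delta>"
  obtains N :: nat and h :: "nat \<Rightarrow> real^'d"
  where "\<And>i. h i \<in> cube" "\<And>t. t \<in> cube \<Longrightarrow> \<exists>i<N. dist t (h i) < \<delta>"
proof -
  have "compact (cube :: (real^'d) set)" by simp
  then obtain F :: "(real^'d) set" where F: "F \<subseteq> cube" "finite F" "cube \<subseteq> (\<Union>c\<in>F. ball c \<delta>)"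
    by (rule compactE_image[where C = cube and f = "\<lambda>c. ball c \<delta>"]) (use assms in auto)
  obtain g where g: "bij_betw g {0..<card F} F"
    using ex_bij_betw_nat_finite[OF F(2)] by blast
  obtain p :: "real^'d" where p: "p \<in> cube" using cube_nonempty by blast
  let ?h = "\<lambda>i. if i < card F then g i else p"
  show thesis
  proof
    show "?h i \<in> cube" for i
      using g F(1) p by (auto simp: bij_betw_def)
    fix t :: "real^'d" assume "t \<in> cube"
    then obtain c where "c \<in> F" "dist t c < \<delta>" using F(3) by (auto simp: dist_commute)
    then obtain i where "i < card F" "c = g i"
      using g unfolding bij_betw_def by (metis atLeastLessThan_iff imageE)
    with \<open>dist t c < \<delta>\<close> show "\<exists>i<card F. dist t (?h i) < \<delta>" by auto
  qed
qed

lemma continuous_imp_measurable_C_paths: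
  fixes f :: "('d::finite) path \<Rightarrow> real"
  assumes f: "continuous_map (Metric_space.mtopology C_paths sup_dist) euclideanreal f"
  shows "f \<in> borel_measurable (path_space C_paths)"
proof -
  interpret C: Metric_space "C_paths :: 'd path set" sup_dist by (rule Metric_space_C_paths)
  have "\<exists>(N::nat) h. (\<forall>i. h i \<in> cube) \<and>
      (\<forall>t\<in>(cube :: (real^'d) set). \<exists>i<N. dist t (h i) < inverse (real (Suc k)))" for k :: nat
  proof -
    have "0 < inverse (real (Suc k))" by simp
    then obtain N :: nat and h :: "nat \<Rightarrow> real^'d"
      where "\<And>i. h i \<in> cube" "\<And>t. t \<in> cube \<Longrightarrow> \<exists>i<N. dist t (h i) < inverse (real (Suc k))"
      by (rule finite_net_cube) blast
    then show ?thesis by blast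
  qed
  then obtain N :: "nat \<Rightarrow> nat" and h :: "nat \<Rightarrow> nat \<Rightarrow> real^'d"
    where h: "\<And>k i. h k i \<in> cube"
      and net: "\<And>k t. t \<in> cube \<Longrightarrow> \<exists>i<N k. dist t (h k i) < inverse (real (Suc k))"
    by metis
  define w where "w k i t = max 0 (inverse (real (Suc k)) - dist t (h k i))" for k i t
  define W where "W k t = (\<Sum>i<N k. w k i t)" for k t
  define G where "G k v = restrict (\<lambda>t. \<Sum>i<N k. v i * (w k i t / W k t)) cube"
    for k :: nat and v :: "nat \<Rightarrow> real"
  define c where "c k x = (\<lambda>i. x (h k i))" for k and x :: "'d path"
  have w0: "0 \<le> w k i t" for k i t by (simp add: w_def)
  have W: "0 < W k t" if t: "t \<in> cube" for k t
  proof -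
    obtain i where "i < N k" "dist t (h k i) < inverse (real (Suc k))" using net[OF t] by blast
    then show ?thesis
      unfolding W_def by (intro sum_pos2[of _ i]) (auto simp: w0, simp add: w_def)
  qed
  have part0: "0 \<le> w k i t / W k t" if "t \<in> cube" for k i t
    using W[OF that, of k] w0[of k i t] by simp
  have part1: "(\<Sum>i<N k. w k i t / W k t) = 1" if "t \<in> cube" for k t
    using W[OF that, of k] by (simp add: sum_divide_distrib[symmetric] W_def[symmetric])
  have G_in: "G k v \<in> C_paths" for k v
  proof -
    have "continuous_on cube (\<lambda>t. \<Sum>i<N k. v i * (w k i t / W k t))"
      unfolding W_def w_def
      by (intro continuous_intros) (use W in \<open>auto simp: W_def w_def less_imp_neq[symmetric] dest: less_imp_neq\<close>)
    then have "continuous_on cube (G k v)"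
      by (rule continuous_on_eq) (simp add: G_def)
    then show ?thesis by (simp add: C_paths_def G_def)
  qed
  have CD: "x \<in> D_paths" if "x \<in> C_paths" for x :: "'d path"
    using that C_paths_subset_D_paths by blast
  have "continuous_map euclidean C.mtopology (G k)" for k
    unfolding C.continuous_map_to_metric
  proof (intro ballI allI impI)
    fix v :: "nat \<Rightarrow> real" and \<epsilon> :: real assume \<epsilon>: "0 < \<epsilon>"
    let ?U = "{u :: nat \<Rightarrow> real. (\<Sum>i<N k. \<bar>v i - u i\<bar>) < \<epsilon>}"
    have U_open: "open ?U"
      by (intro open_Collect_less continuous_intros continuous_on_product_coordinates)
    have U_mem: "v \<in> ?U" using \<epsilon> by simp
    have U_ball: "G k u \<in> C.mball (G k v) \<epsilon>" if u: "u \<in> ?U" for u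
    proof -
      have "\<bar>G k v t - G k u t\<bar> \<le> (\<Sum>i<N k. \<bar>v i - u i\<bar>)" if t: "t \<in> cube" for t
      proof -
        have "G k v t - G k u t = (\<Sum>i<N k. (v i - u i) * (w k i t / W k t))"
          using t by (simp add: G_def sum_subtractf left_diff_distrib diff_divide_distrib)
        also have "\<bar>\<dots>\<bar> \<le> (\<Sum>i<N k. \<bar>(v i - u i) * (w k i t / W k t)\<bar>)"
          by (rule sum_abs)
        also have "\<dots> \<le> (\<Sum>i<N k. \<bar>v i - u i\<bar>)"
        proof (rule sum_mono)
          fix i assume "i \<in> {..<N k}"
          then have "w k i t / W k t \<le> (\<Sum>i<N k. w k i t / W k t)"
            using part0[OF t] by (intro member_le_sum) auto
          then have "w k i t / W k t \<le> 1" using part1[OF t] by simp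
          then show "\<bar>(v i - u i) * (w k i t / W k t)\<bar> \<le> \<bar>v i - u i\<bar>"
            using part0[OF t, of k i] by (simp only: abs_mult abs_of_nonneg) (rule mult_left_le, auto)
        qed
        finally show ?thesis .
      qed
      then have "sup_dist (G k v) (G k u) \<le> (\<Sum>i<N k. \<bar>v i - u i\<bar>)"
        by (simp add: sup_dist_le_iff CD G_in)
      then show ?thesis using u G_in by simp
    qed
    show "\<exists>U. openin euclidean U \<and> v \<in> U \<and> (\<forall>y\<in>U. G k y \<in> C.mball (G k v) \<epsilon>)"
      using U_open U_mem U_ball by (intro exI[of _ ?U] conjI ballI) (simp_all only: open_openin)
  qed
  then have "continuous_map euclidean euclideanreal (f \<circ> G k)" for k
    using continuous_map_compose f by blast
  then have fG: "f \<circ> G k \<in> borel_measurable borel" for k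
    by (intro borel_measurable_continuous_onI) simp
  have ext: "C_paths \<subseteq> (extensional cube :: 'd path set)" by (auto simp: C_paths_def)
  have ident: "(\<lambda>x. x) \<in> path_space C_paths \<rightarrow>\<^sub>M path_space (C_paths :: 'd path set)"
    by (rule measurable_ident_sets) (rule refl)
  have ev: "(\<lambda>x. x t) \<in> borel_measurable (path_space (C_paths :: 'd path set))"
    if "t \<in> cube" for t
    using that iffD1[OF measurable_path_space_iff[OF ext] ident] by (elim conjE) (rule bspec)
  have ck: "c k \<in> borel_measurable (path_space C_paths)" for k
    unfolding c_def by (intro measurable_coordinatewise_then_product ev h)
  have meas: "(\<lambda>x. f (G k (c k x))) \<in> borel_measurable (path_space C_paths)" for k
    using measurable_compose[OF ck fG] by (simp only: comp_def)
  have lim: "(\<lambda>k. f (G k (c k x))) \<longlonglongrightarrow> f x" if "x \<in> space (path_space C_paths)" for x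
  proof -
    have x: "x \<in> C_paths"
      using that by (simp add: path_space_def space_restrict_space)
    have "limitin C.mtopology (\<lambda>k. G k (c k x)) x sequentially"
      unfolding C.limitin_metric
    proof (intro conjI allI impI x)
      fix \<epsilon> :: real assume \<epsilon>: "0 < \<epsilon>"
      have "uniformly_continuous_on cube x"
        using x by (intro compact_uniformly_continuous) (auto simp: C_paths_def)
      then obtain \<delta> where \<delta>: "0 < \<delta>"
        "\<And>s t. s \<in> cube \<Longrightarrow> t \<in> cube \<Longrightarrow> dist s t < \<delta> \<Longrightarrow> dist (x s) (x t) < \<epsilon> / 2"
        using \<epsilon> unfolding uniformly_continuous_on_def by (metis half_gt_zero)
      obtain K where K: "inverse (real (Suc K)) < \<delta>"
        using reals_Archimedean[OF \<delta>(1)] by blast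
      have close: "sup_dist (G k (c k x)) x \<le> \<epsilon> / 2" if k: "K \<le> k" for k
      proof -
        have small: "inverse (real (Suc k)) < \<delta>"
        proof -
          have "inverse (real (Suc k)) \<le> inverse (real (Suc K))"
            using k by (intro le_imp_inverse_le) auto
          with K show ?thesis by linarith
        qed
        have "\<bar>G k (c k x) t - x t\<bar> \<le> \<epsilon> / 2" if t: "t \<in> cube" for t
        proof -
          have "x t = (\<Sum>i<N k. x t * (w k i t / W k t))"
            using part1[OF t] by (simp only: sum_distrib_left[symmetric] mult_1_right)
          then have "G k (c k x) t - x t = (\<Sum>i<N k. (x (h k i) - x t) * (w k i t / W k t))"
            using t by (simp add: G_def c_def sum_subtractf left_diff_distrib diff_divide_distrib)
          also have "\<bar>\<dots>\<bar> \<le> (\<Sum>i<N k. \<bar>(x (h k i) - x t) * (w k i t / W k t)\<bar>)"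
            by (rule sum_abs)
          also have "\<dots> \<le> (\<Sum>i<N k. \<epsilon> / 2 * (w k i t / W k t))"
          proof (rule sum_mono)
            fix i
            have "\<bar>x (h k i) - x t\<bar> \<le> \<epsilon> / 2" if "w k i t \<noteq> 0"
            proof -
              have "dist t (h k i) < inverse (real (Suc k))"
                using that unfolding w_def by (auto simp: max_def split: if_splits)
              then have "dist (h k i) t < \<delta>" using small by (simp add: dist_commute)
              then show ?thesis using \<delta>(2)[OF h t] by (simp add: dist_real_def less_imp_le)
            qed
            then have "w k i t \<noteq> 0 \<Longrightarrow>
                \<bar>x (h k i) - x t\<bar> * (w k i t / W k t) \<le> \<epsilon> / 2 * (w k i t / W k t)"
              using part0[OF t, of k i] by (intro mult_right_mono)
            then show "\<bar>(x (h k i) - x t) * (w k i t / W k t)\<bar> \<le> \<epsilon> / 2 * (w k i t / W k t)"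
              unfolding abs_mult abs_of_nonneg[OF part0[OF t, of k i]]
              by (cases "w k i t = 0") (simp, blast)
          qed
          also have "\<dots> = \<epsilon> / 2"
            using part1[OF t] by (simp only: sum_distrib_left[symmetric] mult_1_right)
          finally show ?thesis .
        qed
        then show ?thesis
          unfolding sup_dist_le_iff[OF CD[OF G_in] CD[OF x]] by blast
      qed
      show "\<forall>\<^sub>F k in sequentially. G k (c k x) \<in> C_paths \<and> sup_dist (G k (c k x)) x < \<epsilon>"
        unfolding eventually_sequentially
      proof (intro exI[of _ K] allI impI conjI G_in)
        fix k assume "K \<le> k"
        then have "sup_dist (G k (c k x)) x \<le> \<epsilon> / 2" by (rule close)
        with \<epsilon> show "sup_dist (G k (c k x)) x < \<epsilon>" by linarith
      qed
    qed
    from continuous_map_limit[OF f this] show ?thesis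
      by (simp add: comp_def)
  qed
  show ?thesis
    by (rule borel_measurable_LIMSEQ_real[OF lim meas])
qed

lemma weakly_converges_C_paths_iff:
  "weakly_converges C_paths P X Q Y \<longleftrightarrow>
     (\<forall>f :: ('d::finite) path \<Rightarrow> real.
        continuous_map (Metric_space.mtopology C_paths sup_dist) euclideanreal f \<longrightarrow>
        bounded (f ` C_paths) \<longrightarrow>
        (\<lambda>n. \<integral>\<omega>. f (X n \<omega>) \<partial>P n) \<longlonglongrightarrow> (\<integral>\<omega>. f (Y \<omega>) \<partial>Q))"
  unfolding weakly_converges_def using continuous_imp_measurable_C_paths by blast

end

theory Submission
  imports Defs
begin

text \<open>
  Write \<open>V m n\<close> for the partial sum over \<open>J m\<close>. Its uniform distance to \<open>\<psi> n\<close>, and to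
  every later partial sum, has expectation at most \<open>\<delta> m\<close>, a constant times the sum of \<open>\<bar>a j\<bar>\<close>
  over \<open>I - J m\<close> (\<open>expected_sup_norm_of_remainder\<close>). This bound is uniform in \<open>n\<close> and tends
  to \<open>0\<close>. Hence for a bounded \<open>L\<close>-Lipschitz functional \<open>g\<close> the expectations of \<open>g (V m n)\<close>,
  \<open>g (V m' n)\<close> and \<open>g (\<psi> n)\<close> differ by at most \<open>L * \<delta> m\<close>. Letting \<open>n\<close> tend to infinity,
  the laws of the \<open>Z m\<close> form a Cauchy sequence for the bounded Lipschitz functionals. If
  they have a limit \<open>Y\<close>, then comparing \<open>\<psi> n\<close> with \<open>V m n\<close>, \<open>V m n\<close> with \<open>Z m\<close> and
  \<open>Z m\<close> with \<open>Y\<close> gives convergence of \<open>\<psi> n\<close> to \<open>Y\<close> for bounded Lipschitz functionals.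

  The work is thus in two general facts about a metric space with a complete separable part
  \<open>C\<close>, here the continuous paths among the cadlag ones.

  The first is that the limit law exists (\<open>cauchy_laws_converge\<close>), which is the completeness
  of the space of laws on \<open>C\<close>. Let \<open>y\<close> be dense in \<open>C\<close>, and encode a point \<open>x\<close> by the
  sequence whose \<open>k\<close>-th letter is the least \<open>i\<close> such that \<open>y i\<close> is within \<open>2\<^sup>-\<^sup>k\<close> of \<open>x\<close>. The
  Cauchy property makes each letter of the codes of the \<open>Z m\<close> tight
  (\<open>uniform_tightness\<close>). So along a subsequence the probabilities of all finite prefixes converge,
  no mass is lost, and the limits are the prefix probabilities of a random sequence of
  letters (\<open>tight_nat_sequences_subsequence\<close>), which is realised as the path of a walk in
  the tree of finite sequences. Almost surely each prefix of that sequence is the prefix of the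
  code of some point of \<open>C\<close>; so the points \<open>y i\<close> that its letters name form a Cauchy sequence,
  and the limit of the latter is \<open>Y\<close>.

  The second is that bounded Lipschitz functionals determine weak convergence towards a law on
  \<open>C\<close> (\<open>expectations_converge_of_test_funs\<close>). The cadlag paths are not separable, and the usual
  Lipschitz minorants of a continuous functional \<open>f\<close>, infima over all paths, need not be
  measurable for the evaluations. It is enough, however, to have countably many measurable
  minorants whose supremum equals \<open>f\<close> on \<open>C\<close>, and these can be built from the distances to the
  points \<open>y i\<close> (\<open>approximation_from_below\<close>).
\<close>

section \<open>Random walks in the tree of finite sequences\<close>

text \<open>The choice \<open>w s\<close> made at the node \<open>s\<close> is the letter that the walk appends there. With
  independent choices at all nodes, the walk can have any prescribed law.\<close>
primrec walk :: "(nat list \<Rightarrow> nat) \<Rightarrow> nat \<Rightarrow> nat list" where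
  "walk w 0 = []"
| "walk w (Suc n) = walk w n @ [w (walk w n)]"

lemma length_walk [simp]: "length (walk w n) = n"
  by (induction n) auto

text \<open>The nodes that the walk visits before \<open>s\<close> are the proper prefixes of \<open>s\<close>. They are
  distinct, so that reaching \<open>s\<close> is an event about finitely many coordinates of \<open>w\<close>.\<close>
lemma walk_eq_iff: "walk w (length s) = s \<longleftrightarrow> (\<forall>k<length s. w (take k s) = s ! k)"
proof (induction s rule: rev_induct)
  case (snoc i s)
  have "walk w (length (s @ [i])) = s @ [i] \<longleftrightarrow> walk w (length s) = s \<and> w s = i"
    by auto
  also have "\<dots> \<longleftrightarrow> (\<forall>k<length s. w (take k s) = s ! k) \<and> w s = i"
    by (simp add: snoc.IH)
  also have "\<dots> \<longleftrightarrow> (\<forall>k<length (s @ [i]). w (take k (s @ [i])) = (s @ [i]) ! k)"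
    by (auto simp: less_Suc_eq nth_append)
  finally show ?case .
qed simp

lemma walk_eq_iff_letters:
  "walk w (length s) = s \<longleftrightarrow> (\<forall>k<length s. w (walk w k) = s ! k)"
proof (induction s rule: rev_induct)
  case (snoc i s)
  have "walk w (length (s @ [i])) = s @ [i] \<longleftrightarrow> walk w (length s) = s \<and> w (walk w (length s)) = i"
    by auto
  also have "\<dots> \<longleftrightarrow> (\<forall>k<length (s @ [i]). w (walk w k) = (s @ [i]) ! k)"
    by (auto simp: snoc.IH less_Suc_eq nth_append)
  finally show ?case .
qed simp

text \<open>A consistent family of prefix probabilities is realised by independent choices: at the node
  \<open>s\<close> the letter \<open>i\<close> is chosen with the conditional probability \<open>q (s @ [i]) / q s\<close>, and
  the probability of reaching \<open>s\<close> is the telescoping product of these along \<open>s\<close>. The product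
  measure thereby takes the place of an extension theorem for projective families.\<close>
lemma exists_walk_law:
  fixes q :: "nat list \<Rightarrow> real"
  assumes Nil: "q [] = 1" and nonneg: "\<And>s. 0 \<le> q s"
    and split: "\<And>s. (\<lambda>i. q (s @ [i])) sums q s"
  obtains K :: "nat list \<Rightarrow> nat pmf"
  where "\<And>s. measure (PiM UNIV (\<lambda>s. measure_pmf (K s))) {w. walk w (length s) = s} = q s"
proof
  \<comment> \<open>nodes of probability zero are never visited, so any law will do there\<close>
  define K where "K s = (if q s = 0 then return_pmf 0 else embed_pmf (\<lambda>i. q (s @ [i]) / q s))" for s
  have K: "q s * pmf (K s) i = q (s @ [i])" for s i
  proof (cases "q s = 0")
    case True
    have "q (s @ [i]) \<le> q s"
      using sum_le_suminf[OF sums_summable[OF split], of "{i}" s] sums_unique[OF split, of s] nonneg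
      by auto
    with True nonneg[of "s @ [i]"] show ?thesis by simp
  next
    case False
    then have pos: "0 < q s" using nonneg[of s] by simp
    have "(\<integral>\<^sup>+ i. ennreal (q (s @ [i]) / q s) \<partial>count_space UNIV) = (\<Sum>i. ennreal (q (s @ [i]) / q s))"
      by (rule nn_integral_count_space_nat)
    also have "\<dots> = ennreal (q s / q s)"
      using pos nonneg
      by (intro suminf_ennreal_eq sums_divide split) auto
    finally have "pmf (embed_pmf (\<lambda>i. q (s @ [i]) / q s)) i = q (s @ [i]) / q s"
      using pos nonneg by (intro pmf_embed_pmf) auto
    with False show ?thesis by (simp add: K_def)
  qed
  interpret product_prob_space "\<lambda>s. measure_pmf (K s)" UNIV
    by unfold_locales
  show "measure (PiM UNIV (\<lambda>s. measure_pmf (K s))) {w. walk w (length s) = s} = q s" for s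
  proof -
    let ?L = "(\<lambda>k. take k s) ` {..<length s}"
    have inj: "inj_on (\<lambda>k. take k s) {..<length s}"
      by (rule inj_on_inverseI[where g = length]) auto
    have "emeasure (PiM UNIV (\<lambda>s. measure_pmf (K s))) {w. walk w (length s) = s}
      = emeasure (PiM UNIV (\<lambda>s. measure_pmf (K s)))
          {w \<in> space (PiM UNIV (\<lambda>s. measure_pmf (K s))). \<forall>t\<in>?L. w t \<in> {s ! length t}}"
      by (rule arg_cong[where f = "emeasure _"]) (auto simp: walk_eq_iff space_PiM)
    also have "\<dots> = (\<Prod>t\<in>?L. emeasure (measure_pmf (K t)) {s ! length t})"
      by (rule emeasure_PiM_Collect) auto
    also have "\<dots> = (\<Prod>k<length s. ennreal (pmf (K (take k s)) (s ! k)))"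
      by (subst prod.reindex[OF inj]) (auto intro!: prod.cong simp: emeasure_pmf_single)
    also have "\<dots> = ennreal (\<Prod>k<length s. pmf (K (take k s)) (s ! k))"
      by (rule prod_ennreal) simp
    also have "(\<Prod>k<length s. pmf (K (take k s)) (s ! k)) = q s"
    proof (induction s rule: rev_induct)
      case (snoc i s)
      then show ?case by (simp add: nth_append K[symmetric])
    qed (simp add: Nil)
    finally show ?thesis
      using nonneg by (simp add: measure_def)
  qed
qed

text \<open>Prokhorov's theorem for random sequences of natural numbers. The vector of all prefix
  probabilities lies in a compact metrizable cube, which yields a subsequence along which every
  prefix probability converges. Tightness of each letter keeps mass from escaping, so that the limits
  still satisfy the consistency condition of \<open>exists_walk_law\<close>.\<close>
lemma tight_nat_sequences_subsequence:
  fixes W :: "nat \<Rightarrow> nat \<Rightarrow> 'v \<Rightarrow> nat"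
  assumes Q: "\<And>m. prob_space (Q m)"
    and W: "\<And>m k. W m k \<in> Q m \<rightarrow>\<^sub>M count_space UNIV"
    and tight: "\<And>k e. 0 < e \<Longrightarrow> \<exists>N. \<forall>m. measure (Q m) {w \<in> space (Q m). N \<le> W m k w} \<le> e"
  obtains r :: "nat \<Rightarrow> nat" and R :: "(nat list \<Rightarrow> nat) measure" and e :: "nat \<Rightarrow> (nat list \<Rightarrow> nat) \<Rightarrow> nat"
  where "strict_mono r" "prob_space R" "\<And>k. e k \<in> R \<rightarrow>\<^sub>M count_space UNIV"
    "\<And>s. (\<lambda>j. measure (Q (r j)) {w \<in> space (Q (r j)). \<forall>k<length s. W (r j) k w = s ! k})
      \<longlonglongrightarrow> measure R {w \<in> space R. \<forall>k<length s. e k w = s ! k}"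
proof -
  define p where "p m s = measure (Q m) {w \<in> space (Q m). \<forall>k<length s. W m k w = s ! k}" for m s
  have W' [measurable]: "Measurable.pred (Q m) (\<lambda>w. P (W m k w))" for m k P
    by (rule measurable_compose[OF W]) simp
  have p01: "p m s \<in> {0..1}" for m s
    using prob_space.prob_le_1[OF Q] by (simp add: p_def)
  have "compact (PiE UNIV (\<lambda>s::nat list. {0..1::real}))"
    using compactin_PiE[of "\<lambda>_. euclidean" UNIV "\<lambda>s::nat list. {0..1::real}"]
    by (simp add: euclidean_product_topology)
  then have "seq_compact (PiE UNIV (\<lambda>s::nat list. {0..1::real}))"
    by (rule compact_imp_seq_compact)
  moreover have "\<forall>m. p m \<in> PiE UNIV (\<lambda>s::nat list. {0..1::real})"
    using p01 by auto
  ultimately obtain q r where q: "q \<in> PiE UNIV (\<lambda>s::nat list. {0..1::real})"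
    and r: "strict_mono r" and lim: "(p \<circ> r) \<longlonglongrightarrow> q"
    by (rule seq_compactE)
  have lim': "(\<lambda>j. p (r j) s) \<longlonglongrightarrow> q s" for s
  proof -
    have "isCont (\<lambda>f::nat list \<Rightarrow> real. f s) q"
      using continuous_on_product_coordinates[of s, where 'b = real]
      unfolding continuous_on_eq_continuous_at[OF open_UNIV] by blast
    then show ?thesis
      using isCont_tendsto_compose[OF _ lim] by (simp add: comp_def)
  qed
  have p_split: "(\<Sum>i<N. p m (s @ [i])) \<le> p m s"
    "p m s \<le> (\<Sum>i<N. p m (s @ [i])) + measure (Q m) {w \<in> space (Q m). N \<le> W m (length s) w}"
    for m s N
  proof -
    interpret prob_space "Q m" by (rule Q)
    let ?A = "{w \<in> space (Q m). \<forall>k<length s. W m k w = s ! k}"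
    let ?B = "\<lambda>i. {w \<in> space (Q m). \<forall>k<length (s @ [i]). W m k w = (s @ [i]) ! k}"
    have B: "?B i = {w \<in> ?A. W m (length s) w = i}" for i
      by (auto simp: nth_append less_Suc_eq)
    have eq: "(\<Sum>i<N. p m (s @ [i])) = measure (Q m) (\<Union>i<N. ?B i)"
      unfolding p_def by (intro finite_measure_finite_Union[symmetric]) (auto simp: disjoint_family_on_def B)
    have "measure (Q m) (\<Union>i<N. ?B i) \<le> p m s"
      unfolding p_def by (intro finite_measure_mono) (auto simp: nth_append less_Suc_eq)
    then show "(\<Sum>i<N. p m (s @ [i])) \<le> p m s"
      by (simp only: eq)
    have "p m s \<le> measure (Q m) ((\<Union>i<N. ?B i) \<union> {w \<in> space (Q m). N \<le> W m (length s) w})"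
      unfolding p_def by (intro finite_measure_mono) (auto simp: nth_append less_Suc_eq not_le)
    also have "\<dots> \<le> measure (Q m) (\<Union>i<N. ?B i) + measure (Q m) {w \<in> space (Q m). N \<le> W m (length s) w}"
      by (intro measure_Un_le) auto
    finally show "p m s \<le> (\<Sum>i<N. p m (s @ [i])) + measure (Q m) {w \<in> space (Q m). N \<le> W m (length s) w}"
      by (simp only: eq)
  qed
  have nonneg: "0 \<le> q s" for s using q by (auto simp: PiE_iff)
  have q_le: "(\<Sum>i<N. q (s @ [i])) \<le> q s" for s N
    by (rule LIMSEQ_le[OF tendsto_sum[OF lim'] lim']) (use p_split(1) in auto)
  have "(\<lambda>i. q (s @ [i])) sums q s" for s
    unfolding sums_def
  proof (rule LIMSEQ_I)
    fix e :: real assume "0 < e"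
    then obtain N where N: "\<And>m. measure (Q m) {w \<in> space (Q m). N \<le> W m (length s) w} \<le> e / 2"
      using tight[of "e/2"] by auto
    have "p (r j) s \<le> (\<Sum>i<N. p (r j) (s @ [i])) + e / 2" for j
      using p_split(2)[of "r j" s N] N[of "r j"] by linarith
    then have "q s \<le> (\<Sum>i<N. q (s @ [i])) + e / 2"
      by (intro LIMSEQ_le[OF lim' tendsto_add[OF tendsto_sum[OF lim'] tendsto_const]]) auto
    moreover have "(\<Sum>i<N. q (s @ [i])) \<le> (\<Sum>i<n. q (s @ [i]))" if "N \<le> n" for n
      by (rule sum_mono2) (use that nonneg in auto)
    ultimately show "\<exists>n0. \<forall>n\<ge>n0. norm ((\<Sum>i<n. q (s @ [i])) - q s) < e"
      using q_le[of s] \<open>0 < e\<close> by (intro exI[of _ N] allI impI) (smt (verit, best) field_sum_of_halves real_norm_def)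
  qed
  moreover have "q [] = 1"
  proof -
    have "p m [] = 1" for m using prob_space.prob_space[OF Q] by (simp add: p_def)
    then show ?thesis using lim'[of "[]"] by (simp add: LIMSEQ_const_iff)
  qed
  ultimately obtain K where K:
    "\<And>s. measure (PiM UNIV (\<lambda>s. measure_pmf (K s))) {w. walk w (length s) = s} = q s"
    using exists_walk_law[of q] nonneg by metis
  let ?R = "PiM UNIV (\<lambda>s. measure_pmf (K s))"
  interpret product_prob_space "\<lambda>s. measure_pmf (K s)" UNIV
    by unfold_locales
  have walk: "(\<lambda>w. walk w k) \<in> ?R \<rightarrow>\<^sub>M count_space UNIV" for k
  proof -
    have "{w \<in> space ?R. walk w k = s} \<in> sets ?R" for s
    proof (cases "length s = k")
      case True
      have "{w \<in> space ?R. walk w (length s) = s} \<in> sets ?R"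
        unfolding walk_eq_iff by measurable
      with True show ?thesis by simp
    next
      case False
      then have empty: "{w \<in> space ?R. walk w k = s} = {}" by auto
      show ?thesis unfolding empty by (rule sets.empty_sets)
    qed
    then show ?thesis
      by (intro measurable_count_space_eq2_countable[THEN iffD2])
         (auto simp: vimage_def Int_def conj_commute)
  qed
  show thesis
  proof (rule that[OF r P.prob_space_axioms])
    show "(\<lambda>w. w (walk w k)) \<in> ?R \<rightarrow>\<^sub>M count_space UNIV" for k
      by (rule measurable_compose_countable[OF _ walk]) auto
    show "(\<lambda>j. measure (Q (r j)) {w \<in> space (Q (r j)). \<forall>k<length s. W (r j) k w = s ! k})
      \<longlonglongrightarrow> measure ?R {w \<in> space ?R. \<forall>k<length s. w (walk w k) = s ! k}" for s
      using lim'[of s] K[of s] by (simp add: p_def walk_eq_iff_letters space_PiM)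
  qed
qed

text \<open>For a countable set of values, pointwise convergence of the probabilities to those of a
  random variable is enough, since no mass can escape: a finite set that carries almost all
  of the limit law carries almost all of the laws far out in the sequence.\<close>
lemma countable_valued_expectation_convergence:
  fixes X :: "nat \<Rightarrow> 'v \<Rightarrow> 'a::countable" and h :: "'a \<Rightarrow> real"
  assumes P: "\<And>j. prob_space (P j)" and R: "prob_space R"
    and X: "\<And>j. X j \<in> P j \<rightarrow>\<^sub>M count_space UNIV" and Y: "Y \<in> R \<rightarrow>\<^sub>M count_space UNIV"
    and lim: "\<And>s. (\<lambda>j. measure (P j) {w \<in> space (P j). X j w = s}) \<longlonglongrightarrow> measure R {w \<in> space R. Y w = s}"
    and bound: "\<And>s. \<bar>h s\<bar> \<le> B"
  shows "(\<lambda>j. \<integral>w. h (X j w) \<partial>P j) \<longlonglongrightarrow> (\<integral>w. h (Y w) \<partial>R)"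
proof -
  have B: "0 \<le> B" using bound[of undefined] by linarith
  have trunc: "\<bar>(\<integral>w. h (T w) \<partial>N) - (\<Sum>s\<in>F. h s * measure N {w \<in> space N. T w = s})\<bar>
      \<le> B * (1 - (\<Sum>s\<in>F. measure N {w \<in> space N. T w = s}))"
    if "prob_space N" and T: "T \<in> N \<rightarrow>\<^sub>M count_space UNIV" and F: "finite F"
    for N :: "'u measure" and T :: "'u \<Rightarrow> 'a" and F
  proof -
    interpret N: prob_space N by fact
    have [measurable]: "Measurable.pred N (\<lambda>w. Q (T w))" for Q
      by (rule measurable_compose[OF T]) simp
    have [measurable]: "(\<lambda>w. h (T w)) \<in> borel_measurable N"
      by (rule measurable_compose[OF T]) simp
    have int_h: "integrable N (\<lambda>w. h (T w))"
      by (rule N.integrable_const_bound[where B = B]) (use bound in auto)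
    have int_ind: "integrable N (indicat_real {w \<in> space N. Q (T w)})" for Q
      by (intro integrable_real_indicator) (auto simp: N.emeasure_eq_measure)
    let ?A = "{w \<in> space N. T w \<in> F}"
    have split: "indicat_real ?A w = (\<Sum>s\<in>F. indicat_real {w \<in> space N. T w = s} w)"
      "h (T w) * indicat_real ?A w = (\<Sum>s\<in>F. h s * indicat_real {w \<in> space N. T w = s} w)"
      if "w \<in> space N" for w
      using that F by (auto simp: indicator_def sum.delta if_distrib cong: if_cong)
    have A: "measure N ?A = (\<Sum>s\<in>F. measure N {w \<in> space N. T w = s})"
    proof -
      have "measure N ?A = (\<integral>w. indicat_real ?A w \<partial>N)" by simp
      also have "\<dots> = (\<integral>w. (\<Sum>s\<in>F. indicat_real {w \<in> space N. T w = s} w) \<partial>N)"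
        by (rule Bochner_Integration.integral_cong) (simp_all only: split(1))
      also have "\<dots> = (\<Sum>s\<in>F. measure N {w \<in> space N. T w = s})"
        by (subst Bochner_Integration.integral_sum) (auto intro: int_ind)
      finally show ?thesis .
    qed
    have "(\<integral>w. h (T w) * indicat_real ?A w \<partial>N)
        = (\<integral>w. (\<Sum>s\<in>F. h s * indicat_real {w \<in> space N. T w = s} w) \<partial>N)"
      by (rule Bochner_Integration.integral_cong) (simp_all only: split(2))
    also have "\<dots> = (\<Sum>s\<in>F. h s * measure N {w \<in> space N. T w = s})"
      by (subst Bochner_Integration.integral_sum) (auto intro: int_ind)
    finally have "(\<integral>w. h (T w) \<partial>N) - (\<Sum>s\<in>F. h s * measure N {w \<in> space N. T w = s})
        = (\<integral>w. h (T w) \<partial>N) - (\<integral>w. h (T w) * indicat_real ?A w \<partial>N)"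
      by simp
    also have "\<dots> = (\<integral>w. h (T w) - h (T w) * indicat_real ?A w \<partial>N)"
      by (intro Bochner_Integration.integral_diff[symmetric] int_h integrable_real_mult_indicator) measurable
    also have "\<bar>\<dots>\<bar> \<le> (\<integral>w. \<bar>h (T w) - h (T w) * indicat_real ?A w\<bar> \<partial>N)"
      by (rule integral_abs_bound)
    also have "\<dots> \<le> (\<integral>w. B * (1 - indicat_real ?A w) \<partial>N)"
      using bound B int_h
      by (intro integral_mono integrable_abs Bochner_Integration.integrable_diff
          integrable_mult_right integrable_real_mult_indicator int_ind)
        (auto simp: indicator_def)
    also have "\<dots> = B * (1 - measure N ?A)"
      using Bochner_Integration.integral_diff[OF N.integrable_const[of 1] int_ind[of "\<lambda>s. s \<in> F"]]
      by (simp add: N.prob_space)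
    finally show ?thesis by (simp only: A)
  qed
  interpret R: prob_space R by (rule R)
  let ?p = "\<lambda>j s. measure (P j) {w \<in> space (P j). X j w = s}"
  let ?q = "\<lambda>s. measure R {w \<in> space R. Y w = s}"
  have [measurable]: "Measurable.pred R (\<lambda>w. Q (Y w))" for Q
    by (rule measurable_compose[OF Y]) simp
  show ?thesis
  proof (rule LIMSEQ_I)
    fix e :: real assume e: "0 < e"
    \<comment> \<open>a finite set of values that carries almost all of the limit law\<close>
    have "(\<lambda>n. measure R {w \<in> space R. to_nat (Y w) < n}) \<longlonglongrightarrow> measure R (\<Union>n. {w \<in> space R. to_nat (Y w) < n})"
      by (rule R.finite_Lim_measure_incseq) (auto simp: incseq_def)
    also have "(\<Union>n. {w \<in> space R. to_nat (Y w) < n}) = space R"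
      by auto
    finally have "(\<lambda>n. measure R {w \<in> space R. to_nat (Y w) < n}) \<longlonglongrightarrow> 1"
      by (simp add: R.prob_space)
    then have "\<forall>\<^sub>F n in sequentially. 1 - e / (4 * (B + 1)) < measure R {w \<in> space R. to_nat (Y w) < n}"
      by (rule order_tendstoD) (use e B in simp)
    then obtain n where n: "1 - e / (4 * (B + 1)) < measure R {w \<in> space R. to_nat (Y w) < n}"
      by (auto simp: eventually_sequentially)
    define F where "F = (to_nat :: 'a \<Rightarrow> nat) -` {..<n}"
    have F: "finite F" unfolding F_def by (rule finite_vimageI) auto
    have "measure R {w \<in> space R. to_nat (Y w) < n} = measure R (\<Union>s\<in>F. {w \<in> space R. Y w = s})"
      by (rule arg_cong[where f = "measure R"]) (auto simp: F_def)
    also have "\<dots> = (\<Sum>s\<in>F. ?q s)"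
      by (rule R.finite_measure_finite_Union[OF F]) (auto simp: disjoint_family_on_def)
    finally have qF: "1 - (\<Sum>s\<in>F. ?q s) < e / (4 * (B + 1))" using n by simp
    have "(\<lambda>j. B * (1 - (\<Sum>s\<in>F. ?p j s)) + \<bar>(\<Sum>s\<in>F. h s * ?p j s) - (\<Sum>s\<in>F. h s * ?q s)\<bar>)
      \<longlonglongrightarrow> B * (1 - (\<Sum>s\<in>F. ?q s)) + \<bar>(\<Sum>s\<in>F. h s * ?q s) - (\<Sum>s\<in>F. h s * ?q s)\<bar>"
      by (intro tendsto_intros lim)
    moreover have small: "B * (1 - (\<Sum>s\<in>F. ?q s)) < e / 4"
    proof -
      have "B * (1 - (\<Sum>s\<in>F. ?q s)) \<le> B * (e / (4 * (B + 1)))"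
        using qF B by (intro mult_left_mono) auto
      also have "\<dots> < e / 4" using e B by (simp add: field_simps)
      finally show ?thesis .
    qed
    ultimately have "\<forall>\<^sub>F j in sequentially.
        B * (1 - (\<Sum>s\<in>F. ?p j s)) + \<bar>(\<Sum>s\<in>F. h s * ?p j s) - (\<Sum>s\<in>F. h s * ?q s)\<bar> < e / 4"
      by (intro order_tendstoD(2)) auto
    then obtain j0 where j0: "\<And>j. j0 \<le> j \<Longrightarrow>
        B * (1 - (\<Sum>s\<in>F. ?p j s)) + \<bar>(\<Sum>s\<in>F. h s * ?p j s) - (\<Sum>s\<in>F. h s * ?q s)\<bar> < e / 4"
      by (auto simp: eventually_sequentially)
    have "\<bar>(\<integral>w. h (X j w) \<partial>P j) - (\<integral>w. h (Y w) \<partial>R)\<bar> < e" if "j0 \<le> j" for j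
      using j0[OF that] trunc[OF P X F, of j] trunc[OF R Y F] small e by linarith
    then show "\<exists>j0. \<forall>j\<ge>j0. norm ((\<integral>w. h (X j w) \<partial>P j) - (\<integral>w. h (Y w) \<partial>R)) < e"
      by auto
  qed
qed

section \<open>Test functions around a separable complete core\<close>

primrec running_max :: "(nat \<Rightarrow> 'a \<Rightarrow> real) \<Rightarrow> nat \<Rightarrow> 'a \<Rightarrow> real" where
  "running_max b 0 x = 0"
| "running_max b (Suc N) x = max (running_max b N x) (b N x)"

lemma running_max_ge: "i < N \<Longrightarrow> b i x \<le> running_max b N x"
  by (induction N) (auto simp: less_Suc_eq)

lemma running_max_nonneg: "0 \<le> running_max b N x"
  by (induction N) auto

lemma running_max_le: "0 \<le> u \<Longrightarrow> (\<And>i. b i x \<le> u) \<Longrightarrow> running_max b N x \<le> u"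
  by (induction N) auto

text \<open>The space \<open>M\<close> itself may be neither separable nor equipped with its Borel sets; the
  \<open>\<sigma>\<close>-algebra \<open>A\<close> has to contain just enough sets to make the distances to the dense sequence
  \<open>y\<close> measurable. All limit laws live on \<open>C\<close>.\<close>
locale measured_separable_core = Metric_space M d for M :: "'a set" and d +
  fixes C :: "'a set" and y :: "nat \<Rightarrow> 'a" and A :: "'a measure"
  assumes core_subset: "C \<subseteq> M"
    and core_complete: "\<And>z. (\<And>n. z n \<in> C) \<Longrightarrow> MCauchy z \<Longrightarrow> \<exists>x\<in>C. limitin mtopology z x sequentially"
    and y_in: "\<And>i. y i \<in> C"
    and y_dense: "\<And>x e. x \<in> C \<Longrightarrow> 0 < e \<Longrightarrow> \<exists>i. d x (y i) < e"
    and space_A: "space A = M"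
    and dist_measurable [measurable]: "\<And>i. (\<lambda>x. d x (y i)) \<in> borel_measurable A"
begin

lemma y_in_M [simp]: "y i \<in> M"
  using y_in core_subset by blast

text \<open>The constant \<open>L\<close> is a parameter because estimates that are uniform in the test function
  depend on it. The size of the bound on \<open>g\<close> enters no estimate and is left open.\<close>
definition test_fun :: "real \<Rightarrow> ('a \<Rightarrow> real) \<Rightarrow> bool" where
  "test_fun L g \<longleftrightarrow> 0 \<le> L \<and> g \<in> borel_measurable A \<and> (\<exists>B. \<forall>x\<in>M. \<bar>g x\<bar> \<le> B) \<and>
     (\<forall>x\<in>M. \<forall>x'\<in>M. \<bar>g x - g x'\<bar> \<le> L * d x x')"

lemma test_funD:
  assumes "test_fun L g"
  shows test_fun_nonneg: "0 \<le> L"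
    and test_fun_measurable: "g \<in> borel_measurable A"
    and test_fun_lipschitz: "x \<in> M \<Longrightarrow> x' \<in> M \<Longrightarrow> \<bar>g x - g x'\<bar> \<le> L * d x x'"
  using assms by (auto simp: test_fun_def)

lemma test_fun_bound:
  assumes "test_fun L g"
  obtains B where "0 \<le> B" "\<And>x. x \<in> M \<Longrightarrow> \<bar>g x\<bar> \<le> B"
proof -
  obtain B where B: "\<And>x. x \<in> M \<Longrightarrow> \<bar>g x\<bar> \<le> B"
    using assms by (auto simp: test_fun_def)
  have "0 \<le> B" using B[OF y_in_M[of 0]] by linarith
  with B show thesis by (rule that[rotated])
qed

lemma test_fun_integrable:
  assumes g: "test_fun L g" and "prob_space N" and X: "X \<in> N \<rightarrow>\<^sub>M A"
  shows "integrable N (\<lambda>w. g (X w))"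
proof -
  interpret prob_space N by fact
  obtain B where B: "\<And>x. x \<in> M \<Longrightarrow> \<bar>g x\<bar> \<le> B" using g by (rule test_fun_bound) blast
  show ?thesis
    using B measurable_space[OF X]
    by (intro integrable_const_bound[where B = B] measurable_compose[OF X test_fun_measurable[OF g]])
       (auto simp: space_A)
qed

lemma test_fun_const: "test_fun 0 (\<lambda>_. c)"
  by (auto simp: test_fun_def)

lemma test_fun_mono: "test_fun L g \<Longrightarrow> L \<le> L' \<Longrightarrow> test_fun L' g"
  unfolding test_fun_def by (meson mult_right_mono Metric_space.nonneg Metric_space_axioms order_trans)

lemma lipschitz_dist:
  assumes "x \<in> M" "x' \<in> M" "z \<in> M" shows "\<bar>d x z - d x' z\<bar> \<le> d x x'"
  using triangle[OF assms(1,2,3)] triangle[OF assms(2,1,3)] commute[of x x'] by linarith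

lemma test_fun_max:
  assumes "test_fun L f" "test_fun L g" shows "test_fun L (\<lambda>x. max (f x) (g x))"
proof -
  obtain B where B: "\<And>x. x \<in> M \<Longrightarrow> \<bar>f x\<bar> \<le> B" using assms(1) by (rule test_fun_bound) blast
  obtain B' where B': "\<And>x. x \<in> M \<Longrightarrow> \<bar>g x\<bar> \<le> B'" using assms(2) by (rule test_fun_bound) blast
  have "\<bar>max (f x) (g x)\<bar> \<le> max B B'" if "x \<in> M" for x
    using B[OF that] B'[OF that] by linarith
  moreover have "\<bar>max (f x) (g x) - max (f x') (g x')\<bar> \<le> L * d x x'" if "x \<in> M" "x' \<in> M" for x x'
    using test_fun_lipschitz[OF assms(1) that] test_fun_lipschitz[OF assms(2) that] by linarith
  moreover have "(\<lambda>x. max (f x) (g x)) \<in> borel_measurable A"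
    using assms by (auto simp: test_fun_def)
  moreover have "0 \<le> L" using assms(1) by (rule test_fun_nonneg)
  ultimately show ?thesis unfolding test_fun_def by blast
qed

lemma test_fun_bump:
  assumes "0 \<le> c" "0 \<le> b"
  shows "test_fun (c * b) (\<lambda>x. c * max 0 (min 1 (2 - b * d x (y i))))"
proof -
  have "\<bar>c * max 0 (min 1 (2 - b * d x (y i)))\<bar> \<le> c" for x
    using assms by (auto simp: abs_mult mult_left_le)
  moreover have "\<bar>c * max 0 (min 1 (2 - b * d x (y i))) - c * max 0 (min 1 (2 - b * d x' (y i)))\<bar>
      \<le> c * b * d x x'" if "x \<in> M" "x' \<in> M" for x x'
  proof -
    have "\<bar>b * d x (y i) - b * d x' (y i)\<bar> \<le> b * d x x'"
      using mult_left_mono[OF lipschitz_dist[OF that y_in_M] assms(2)] assms(2)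
      by (simp add: right_diff_distrib[symmetric] abs_mult)
    then have "\<bar>max 0 (min 1 (2 - b * d x (y i))) - max 0 (min 1 (2 - b * d x' (y i)))\<bar> \<le> b * d x x'"
      by linarith
    from mult_left_mono[OF this assms(1)] assms(1) show ?thesis
      by (simp add: right_diff_distrib[symmetric] abs_mult mult.assoc)
  qed
  ultimately show ?thesis unfolding test_fun_def using assms by (auto intro!: exI[of _ c])
qed

lemma test_fun_expectations_close:
  assumes g: "test_fun L g" and P: "prob_space P" and X: "X \<in> P \<rightarrow>\<^sub>M A" and X': "X' \<in> P \<rightarrow>\<^sub>M A"
    and int: "integrable P (\<lambda>w. d (X w) (X' w))"
  shows "\<bar>(\<integral>w. g (X w) \<partial>P) - (\<integral>w. g (X' w) \<partial>P)\<bar> \<le> L * (\<integral>w. d (X w) (X' w) \<partial>P)"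
proof -
  have ints: "integrable P (\<lambda>w. g (X w))" "integrable P (\<lambda>w. g (X' w))"
    using test_fun_integrable[OF g P] X X' by blast+
  have "\<bar>(\<integral>w. g (X w) \<partial>P) - (\<integral>w. g (X' w) \<partial>P)\<bar> = \<bar>\<integral>w. g (X w) - g (X' w) \<partial>P\<bar>"
    by (simp add: ints)
  also have "\<dots> \<le> (\<integral>w. \<bar>g (X w) - g (X' w)\<bar> \<partial>P)"
    by (rule integral_abs_bound)
  also have "\<dots> \<le> (\<integral>w. L * d (X w) (X' w) \<partial>P)"
    using test_fun_lipschitz[OF g] measurable_space[OF X] measurable_space[OF X']
    by (intro integral_mono integrable_mult_right int integrable_abs Bochner_Integration.integrable_diff ints)
       (auto simp: space_A)
  finally show ?thesis by simp
qed

section \<open>From test functions to continuous functions\<close>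

lemma test_fun_running_max:
  assumes "\<And>i. \<exists>L. test_fun L (b i)"
  shows "\<exists>L. test_fun L (running_max b N)"
proof (induction N)
  case 0
  have "running_max b 0 = (\<lambda>_. 0)" by auto
  then show ?case using test_fun_const[of 0] by auto
next
  case (Suc N)
  then obtain L L' where "test_fun L (running_max b N)" "test_fun L' (b N)"
    using assms by blast
  then have "test_fun (max L L') (\<lambda>x. max (running_max b N x) (b N x))"
    by (intro test_fun_max) (auto intro: test_fun_mono)
  moreover have "running_max b (Suc N) = (\<lambda>x. max (running_max b N x) (b N x))"
    by auto
  ultimately show ?case by auto
qed

text \<open>The minorants are finite maxima of bumps around the points \<open>y j\<close>, of all radii
  \<open>2 / (k + 1)\<close>; the height of a bump is the infimum of \<open>f\<close> over the points
  of \<open>T\<close> where the bump is positive. At a point \<open>x\<close>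
  of \<open>C\<close>, a small bump around some \<open>y j\<close> close to \<open>x\<close> has height almost \<open>f x\<close>, by the
  continuity of \<open>f\<close> at \<open>x\<close>.\<close>
lemma approximation_from_below:
  assumes T: "C \<subseteq> T" "T \<subseteq> M"
    and nonneg: "\<And>x. x \<in> T \<Longrightarrow> 0 \<le> f x"
    and cont: "\<And>x e. x \<in> C \<Longrightarrow> 0 < e \<Longrightarrow> \<exists>r>0. \<forall>z\<in>T. d x z < r \<longrightarrow> \<bar>f z - f x\<bar> < (e::real)"
  obtains g :: "nat \<Rightarrow> 'a \<Rightarrow> real"
  where "\<And>N. \<exists>L. test_fun L (g N)" "\<And>N x. x \<in> T \<Longrightarrow> 0 \<le> g N x \<and> g N x \<le> f x"
    "\<And>x. x \<in> C \<Longrightarrow> (\<lambda>N. g N x) \<longlonglongrightarrow> f x"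
proof -
  define m where "m j k = Inf (f ` {z \<in> T. d z (y j) < 2 / real (Suc k)})" for j k
  define b where "b i x = (case prod_decode i of (j, k) \<Rightarrow>
    m j k * max 0 (min 1 (2 - real (Suc k) * d x (y j))))" for i x
  have y_T: "y j \<in> T" for j using y_in T by blast
  have bdd: "bdd_below (f ` {z \<in> T. d z (y j) < 2 / real (Suc k)})" for j k
    using nonneg by (intro bdd_belowI[of _ 0]) auto
  have ne: "{z \<in> T. d z (y j) < 2 / real (Suc k)} \<noteq> {}" for j k
    using y_T[of j] by (auto intro!: exI[of _ "y j"])
  have m0: "0 \<le> m j k" for j k
    unfolding m_def using ne nonneg by (intro cINF_greatest) auto
  have m_le: "m j k \<le> f x" if "x \<in> T" "d x (y j) < 2 / real (Suc k)" for j k x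
    unfolding m_def using that by (intro cINF_lower bdd) auto
  have b_le: "b i x \<le> f x" if x: "x \<in> T" for i x
  proof -
    obtain j k where i: "prod_decode i = (j, k)" by (cases "prod_decode i")
    show ?thesis
    proof (cases "d x (y j) < 2 / real (Suc k)")
      case True
      have "b i x \<le> m j k * 1"
        unfolding b_def i prod.case by (intro mult_left_mono m0) auto
      with m_le[OF x True] show ?thesis by simp
    next
      case False
      then have "2 \<le> real (Suc k) * d x (y j)"
        by (simp add: field_simps)
      then have "max 0 (min 1 (2 - real (Suc k) * d x (y j))) = 0" by linarith
      then show ?thesis unfolding b_def i prod.case using nonneg[OF x] by simp
    qed
  qed
  show thesis
  proof (rule that[of "running_max b"])
    show "\<exists>L. test_fun L (running_max b N)" for N
    proof (rule test_fun_running_max)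
      show "\<exists>L. test_fun L (b i)" for i
        using test_fun_bump[OF m0[of "fst (prod_decode i)" "snd (prod_decode i)"],
            of "real (Suc (snd (prod_decode i)))" "fst (prod_decode i)"]
        by (intro exI) (simp add: b_def[abs_def] case_prod_unfold)
    qed
    show le: "0 \<le> running_max b N x \<and> running_max b N x \<le> f x" if "x \<in> T" for N x
      by (intro conjI running_max_nonneg running_max_le nonneg[OF that] b_le[OF that])
    show "(\<lambda>N. running_max b N x) \<longlonglongrightarrow> f x" if x: "x \<in> C" for x
    proof (rule LIMSEQ_I)
      fix e :: real assume e: "0 < e"
      have xT: "x \<in> T" and xM: "x \<in> M" using x T by auto
      obtain r where r: "0 < r" "\<And>z. z \<in> T \<Longrightarrow> d x z < r \<Longrightarrow> \<bar>f z - f x\<bar> < e / 2"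
        using cont[OF x, of "e / 2"] e by auto
      obtain k where "inverse (real (Suc k)) < r / 3"
        using reals_Archimedean[of "r / 3"] r by auto
      then have k: "3 / real (Suc k) < r" by (simp add: field_simps)
      obtain j where j: "d x (y j) < 1 / real (Suc k)"
        using y_dense[OF x, of "1 / real (Suc k)"] by auto
      have "f x - e / 2 \<le> m j k"
        unfolding m_def
      proof (rule cINF_greatest[OF ne])
        fix z assume z: "z \<in> {z \<in> T. d z (y j) < 2 / real (Suc k)}"
        then have "z \<in> M" using T by auto
        then have "d x z \<le> d x (y j) + d z (y j)"
          using triangle[OF xM y_in_M[of j], of z] commute[of z "y j"] by simp
        also have "\<dots> < 1 / real (Suc k) + 2 / real (Suc k)" using j z by auto
        also have "\<dots> < r" using k by (simp add: add_divide_distrib[symmetric])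
        finally have "\<bar>f z - f x\<bar> < e / 2" using r(2)[of z] z by blast
        then show "f x - e / 2 \<le> f z" by linarith
      qed
      also have "m j k = b (prod_encode (j, k)) x"
      proof -
        have "1 \<le> 2 - real (Suc k) * d x (y j)" using j by (simp add: field_simps)
        then have "max 0 (min 1 (2 - real (Suc k) * d x (y j))) = 1" by linarith
        then show ?thesis by (simp only: b_def prod_encode_inverse prod.case mult_1_right)
      qed
      finally have low: "f x - e / 2 \<le> b (prod_encode (j, k)) x" .
      have "norm (running_max b N x - f x) < e" if "Suc (prod_encode (j, k)) \<le> N" for N
        using running_max_ge[of "prod_encode (j, k)" N b x] that low le[OF xT, of N] e
        unfolding real_norm_def by linarith
      then show "\<exists>N0. \<forall>N\<ge>N0. norm (running_max b N x - f x) < e" by blast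
    qed
  qed
qed

text \<open>Convergence of the expectations of test functions suffices if the limit lives on \<open>C\<close>.
  Applied to \<open>B + f\<close> and to \<open>B - f\<close>, the approximation from below bounds the lower and the upper
  limit of the expectations of \<open>f\<close>. The set \<open>T\<close> of possible values is a parameter, so that
  functionals that are continuous only on \<open>C\<close> are covered as well as those on all of \<open>M\<close>.\<close>
theorem expectations_converge_of_test_funs:
  fixes X :: "nat \<Rightarrow> 'v \<Rightarrow> 'a" and Y :: "'u \<Rightarrow> 'a" and f :: "'a \<Rightarrow> real"
  assumes P: "\<And>n. prob_space (P n)" and X: "\<And>n. X n \<in> P n \<rightarrow>\<^sub>M A"
    and R: "prob_space R" and Y: "Y \<in> R \<rightarrow>\<^sub>M A"
    and lim: "\<And>L g. test_fun L g \<Longrightarrow> (\<lambda>n. \<integral>w. g (X n w) \<partial>P n) \<longlonglongrightarrow> (\<integral>w. g (Y w) \<partial>R)"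
    and T: "C \<subseteq> T" "T \<subseteq> M" and X_T: "\<And>n w. w \<in> space (P n) \<Longrightarrow> X n w \<in> T"
    and Y_C: "\<And>w. w \<in> space R \<Longrightarrow> Y w \<in> C"
    and cont: "\<And>x e. x \<in> C \<Longrightarrow> 0 < e \<Longrightarrow> \<exists>r>0. \<forall>z\<in>T. d x z < r \<longrightarrow> \<bar>f z - f x\<bar> < e"
    and bound: "\<And>x. x \<in> T \<Longrightarrow> \<bar>f x\<bar> \<le> B"
    and fX: "\<And>n. (\<lambda>w. f (X n w)) \<in> borel_measurable (P n)"
    and fY: "(\<lambda>w. f (Y w)) \<in> borel_measurable R"
  shows "(\<lambda>n. \<integral>w. f (X n w) \<partial>P n) \<longlonglongrightarrow> (\<integral>w. f (Y w) \<partial>R)"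
proof -
  interpret R: prob_space R by (rule R)
  have Y_T: "Y w \<in> T" if "w \<in> space R" for w using Y_C[OF that] T by blast
  have int_X: "integrable (P n) (\<lambda>w. f (X n w))" for n
    using prob_space.finite_measure[OF P] fX bound X_T
    by (intro finite_measure.integrable_const_bound[where B = B]) auto
  have int_Y: "integrable R (\<lambda>w. f (Y w))"
    using fY bound Y_T by (intro R.integrable_const_bound[where B = B]) auto
  have lower: "\<forall>\<^sub>F n in sequentially. (\<integral>w. h (Y w) \<partial>R) - e < (\<integral>w. h (X n w) \<partial>P n)"
    if h: "\<And>x. x \<in> T \<Longrightarrow> 0 \<le> h x" "\<And>n. integrable (P n) (\<lambda>w. h (X n w))" "integrable R (\<lambda>w. h (Y w))"
      and h_cont: "\<And>x e. x \<in> C \<Longrightarrow> 0 < e \<Longrightarrow> \<exists>r>0. \<forall>z\<in>T. d x z < r \<longrightarrow> \<bar>h z - h x\<bar> < e"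
      and e: "0 < e" for h :: "'a \<Rightarrow> real" and e
  proof -
    obtain g :: "nat \<Rightarrow> 'a \<Rightarrow> real"
      where g: "\<And>N. \<exists>L. test_fun L (g N)" "\<And>N x. x \<in> T \<Longrightarrow> 0 \<le> g N x \<and> g N x \<le> h x"
        "\<And>x. x \<in> C \<Longrightarrow> (\<lambda>N. g N x) \<longlonglongrightarrow> h x"
      using approximation_from_below[OF T h(1) h_cont] by blast
    have "(\<lambda>N. \<integral>w. g N (Y w) \<partial>R) \<longlonglongrightarrow> (\<integral>w. h (Y w) \<partial>R)"
    proof (rule integral_dominated_convergence[where w = "\<lambda>w. h (Y w)"])
      show "(\<lambda>w. g N (Y w)) \<in> borel_measurable R" for N
        using g(1)[of N] measurable_compose[OF Y test_fun_measurable] by blast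
      show "AE w in R. (\<lambda>N. g N (Y w)) \<longlonglongrightarrow> h (Y w)"
        using g(3) Y_C by auto
      show "AE w in R. norm (g N (Y w)) \<le> h (Y w)" for N
        using g(2) Y_T by auto
    qed (use h in auto)
    then have "\<forall>\<^sub>F N in sequentially. (\<integral>w. h (Y w) \<partial>R) - e < (\<integral>w. g N (Y w) \<partial>R)"
      by (rule order_tendstoD) (use e in simp)
    then obtain N where N: "(\<integral>w. h (Y w) \<partial>R) - e < (\<integral>w. g N (Y w) \<partial>R)"
      by (auto simp: eventually_sequentially)
    obtain L where L: "test_fun L (g N)" using g(1) by blast
    have "\<forall>\<^sub>F n in sequentially. (\<integral>w. h (Y w) \<partial>R) - e < (\<integral>w. g N (X n w) \<partial>P n)"
      by (rule order_tendstoD(1)[OF lim[OF L] N])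
    moreover have "(\<integral>w. g N (X n w) \<partial>P n) \<le> (\<integral>w. h (X n w) \<partial>P n)" for n
      using g(2) X_T by (intro integral_mono test_fun_integrable[OF L P X] h) auto
    ultimately show ?thesis by (auto elim!: eventually_mono intro: less_le_trans)
  qed
  show ?thesis
  proof (rule tendstoI)
    fix e :: real assume e: "0 < e"
    have "\<forall>\<^sub>F n in sequentially. (\<integral>w. B + f (Y w) \<partial>R) - e < (\<integral>w. B + f (X n w) \<partial>P n)"
    proof (rule lower)
      show "0 \<le> B + f x" if "x \<in> T" for x using bound[OF that] by linarith
      show "integrable (P n) (\<lambda>w. B + f (X n w))" for n
        using int_X prob_space.finite_measure[OF P]
        by (intro Bochner_Integration.integrable_add finite_measure.integrable_const)
      show "integrable R (\<lambda>w. B + f (Y w))" using int_Y by simp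
      show "\<exists>r>0. \<forall>z\<in>T. d x z < r \<longrightarrow> \<bar>B + f z - (B + f x)\<bar> < e" if "x \<in> C" "0 < e" for x e
        using cont[OF that] by simp
    qed (rule e)
    moreover have "\<forall>\<^sub>F n in sequentially. (\<integral>w. B - f (Y w) \<partial>R) - e < (\<integral>w. B - f (X n w) \<partial>P n)"
    proof (rule lower)
      show "0 \<le> B - f x" if "x \<in> T" for x using bound[OF that] by linarith
      show "integrable (P n) (\<lambda>w. B - f (X n w))" for n
        using int_X prob_space.finite_measure[OF P]
        by (intro Bochner_Integration.integrable_diff finite_measure.integrable_const)
      show "integrable R (\<lambda>w. B - f (Y w))" using int_Y by simp
      show "\<exists>r>0. \<forall>z\<in>T. d x z < r \<longrightarrow> \<bar>B - f z - (B - f x)\<bar> < e" if "x \<in> C" "0 < e" for x e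
        using cont[OF that] by (simp add: abs_minus_commute)
    qed (rule e)
    ultimately show "\<forall>\<^sub>F n in sequentially. dist (\<integral>w. f (X n w) \<partial>P n) (\<integral>w. f (Y w) \<partial>R) < e"
    proof eventually_elim
      case (elim n)
      interpret P: prob_space "P n" by (rule P)
      show ?case
        using elim int_X[of n] int_Y
        by (simp add: P.prob_space R.prob_space dist_real_def abs_less_iff)
    qed
  qed
qed

section \<open>Limits of Cauchy sequences of laws\<close>

text \<open>The distance to the first \<open>N\<close> points of the dense sequence, in units of \<open>r\<close> and truncated
  at \<open>1\<close>. Its Lipschitz constant \<open>1 / r\<close> is the same for all \<open>N\<close>; this is what lets a Cauchy
  condition on test functions control all of the laws at once.\<close>
primrec remoteness :: "real \<Rightarrow> nat \<Rightarrow> 'a \<Rightarrow> real" where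
  "remoteness r 0 x = 1"
| "remoteness r (Suc N) x = min (remoteness r N x) (d x (y N) / r)"

lemma remoteness_range: "0 < r \<Longrightarrow> 0 \<le> remoteness r N x" "remoteness r N x \<le> 1"
  by (induction N) auto

lemma remoteness_eq_1: "0 < r \<Longrightarrow> \<forall>i<N. r \<le> d x (y i) \<Longrightarrow> remoteness r N x = 1"
  by (induction N) auto

lemma remoteness_le: "i < N \<Longrightarrow> remoteness r N x \<le> d x (y i) / r"
  by (induction N) (auto simp: less_Suc_eq)

lemma remoteness_antimono: "N \<le> N' \<Longrightarrow> remoteness r N' x \<le> remoteness r N x"
  by (induction rule: dec_induct) auto

lemma remoteness_tendsto_0:
  assumes "x \<in> C" "0 < r" shows "(\<lambda>N. remoteness r N x) \<longlonglongrightarrow> 0"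
proof (rule LIMSEQ_I)
  fix e :: real assume "0 < e"
  then obtain i where i: "d x (y i) < e * r" using y_dense[OF assms(1), of "e * r"] assms by auto
  have "remoteness r N x < e" if "Suc i \<le> N" for N
  proof -
    have "remoteness r N x \<le> d x (y i) / r" using that by (intro remoteness_le) simp
    also have "\<dots> < e" using i assms(2) by (simp add: pos_divide_less_eq)
    finally show ?thesis .
  qed
  then show "\<exists>N0. \<forall>N\<ge>N0. norm (remoteness r N x - 0) < e"
    using remoteness_range(1)[OF assms(2)] by auto
qed

lemma test_fun_remoteness:
  assumes "0 < r" shows "test_fun (1 / r) (remoteness r N)"
proof -
  have meas: "remoteness r N \<in> borel_measurable A"
    by (induction N) auto
  have lip: "\<bar>remoteness r N x - remoteness r N x'\<bar> \<le> 1 / r * d x x'" if "x \<in> M" "x' \<in> M" for x x'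
  proof (induction N)
    case 0
    then show ?case using assms by simp
  next
    case (Suc N)
    have "\<bar>d x (y N) / r - d x' (y N) / r\<bar> \<le> 1 / r * d x x'"
      using divide_right_mono[OF lipschitz_dist[OF that y_in_M], of r N] assms
      by (simp add: diff_divide_distrib[symmetric])
    with Suc show ?case unfolding remoteness.simps by linarith
  qed
  have "\<bar>remoteness r N x\<bar> \<le> 1" for x
    using remoteness_range(1)[OF assms, of N x] remoteness_range(2)[of r N x] by linarith
  moreover have "0 \<le> 1 / r" using assms by simp
  ultimately show ?thesis using meas lip unfolding test_fun_def by blast
qed

definition code :: "real \<Rightarrow> 'a \<Rightarrow> nat" where
  "code r x = (LEAST i. d x (y i) < r)"

lemma dist_code: "x \<in> C \<Longrightarrow> 0 < r \<Longrightarrow> d x (y (code r x)) < r"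
  unfolding code_def by (rule LeastI_ex) (rule y_dense)

lemma less_code: "i < code r x \<Longrightarrow> r \<le> d x (y i)"
  unfolding code_def by (metis not_less_Least not_le)

lemma code_measurable [measurable]: "code r \<in> A \<rightarrow>\<^sub>M count_space UNIV"
  unfolding code_def by measurable

text \<open>The code is at least \<open>N\<close> only where \<open>remoteness r N\<close> is \<open>1\<close>. The expectation of the latter
  tends to \<open>0\<close> as \<open>N\<close> grows, for each of the finitely many laws up to a fixed index \<open>m0\<close>; under
  the later laws it differs from its value at \<open>m0\<close> by at most \<open>\<delta> m0 / r\<close>.\<close>
lemma uniform_tightness:
  fixes Z :: "nat \<Rightarrow> 'v \<Rightarrow> 'a"
  assumes Q: "\<And>m. prob_space (Q m)"
    and Z: "\<And>m. Z m \<in> Q m \<rightarrow>\<^sub>M A" and Z_C: "\<And>m w. w \<in> space (Q m) \<Longrightarrow> Z m w \<in> C"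
    and \<delta>: "\<delta> \<longlonglongrightarrow> 0"
    and close: "\<And>L g m m'. test_fun L g \<Longrightarrow> m \<le> m' \<Longrightarrow>
      \<bar>(\<integral>w. g (Z m w) \<partial>Q m) - (\<integral>w. g (Z m' w) \<partial>Q m')\<bar> \<le> L * \<delta> m"
    and r: "0 < r" and e: "0 < e"
  shows "\<exists>N. \<forall>m. measure (Q m) {w \<in> space (Q m). N \<le> code r (Z m w)} \<le> e"
proof -
  let ?E = "\<lambda>N m. \<integral>w. remoteness r N (Z m w) \<partial>Q m"
  have integrable: "integrable (Q m) (\<lambda>w. remoteness r N (Z m w))" for N m
    by (rule test_fun_integrable[OF test_fun_remoteness[OF r] Q Z])
  have single: "(\<lambda>N. ?E N m) \<longlonglongrightarrow> 0" for m
  proof -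
    interpret prob_space "Q m" by (rule Q)
    have "(\<lambda>N. ?E N m) \<longlonglongrightarrow> (\<integral>w. 0 \<partial>Q m)"
    proof (rule integral_dominated_convergence[where w = "\<lambda>_. 1"])
      show "AE w in Q m. (\<lambda>N. remoteness r N (Z m w)) \<longlonglongrightarrow> 0"
        using remoteness_tendsto_0[OF Z_C r] by auto
      show "AE w in Q m. norm (remoteness r N (Z m w)) \<le> 1" for N
        using remoteness_range(1)[OF r] remoteness_range(2) by auto
    qed (use integrable in auto)
    then show ?thesis by simp
  qed
  have "\<forall>\<^sub>F m in sequentially. \<delta> m < r * e / 2"
    using \<delta> by (rule order_tendstoD) (use r e in simp)
  then obtain m0 where m0: "\<delta> m0 < r * e / 2" by (auto simp: eventually_sequentially)
  have "\<exists>N. ?E N m < e / 2" for m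
    using order_tendstoD(2)[OF single[of m], of "e / 2"] e by (auto simp: eventually_sequentially)
  then obtain N where N: "\<And>m. ?E (N m) m < e / 2" by metis
  define N0 where "N0 = Max (N ` {..m0})"
  have small: "?E N0 m < e / 2" if "m \<le> m0" for m
  proof -
    have "N m \<le> N0" using that by (simp add: N0_def)
    then have "?E N0 m \<le> ?E (N m) m"
      using integrable remoteness_antimono by (intro integral_mono) auto
    with N[of m] show ?thesis by simp
  qed
  have all: "?E N0 m \<le> e" for m
  proof (cases "m \<le> m0")
    case True
    then show ?thesis using small[of m] e by linarith
  next
    case False
    then have "\<bar>?E N0 m0 - ?E N0 m\<bar> \<le> 1 / r * \<delta> m0"
      by (intro close test_fun_remoteness r) auto
    also have "\<dots> < e / 2" using m0 r by (simp add: field_simps)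
    finally show ?thesis using small[of m0] by linarith
  qed
  show ?thesis
  proof (intro exI allI)
    fix m
    interpret prob_space "Q m" by (rule Q)
    have [measurable]: "Z m \<in> Q m \<rightarrow>\<^sub>M A" by (rule Z)
    let ?F = "{w \<in> space (Q m). N0 \<le> code r (Z m w)}"
    have "measure (Q m) ?F = (\<integral>w. indicat_real ?F w \<partial>Q m)" by simp
    also have "\<dots> \<le> ?E N0 m"
    proof (rule integral_mono)
      show "integrable (Q m) (indicat_real ?F)"
        by (intro integrable_real_indicator) (auto simp: emeasure_eq_measure)
      show "indicat_real ?F w \<le> remoteness r N0 (Z m w)" for w
        using remoteness_eq_1[OF r] remoteness_range(1)[OF r] less_code
        by (auto simp: indicator_def)
    qed (rule integrable)
    finally show "measure (Q m) ?F \<le> e" using all[of m] by linarith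
  qed
qed

text \<open>If \<open>x\<close> has the letters \<open>c k\<close> and \<open>c k'\<close> at the positions \<open>k\<close> and \<open>k'\<close> of its code, then
  \<open>y (c k)\<close> and \<open>y (c k')\<close> are both close to \<open>x\<close>, hence to each other. The point \<open>x\<close> may
  depend on the prefix considered, the estimate does not.\<close>
lemma compatible_codes_converge:
  assumes c: "\<And>n. \<exists>x\<in>C. \<forall>k<n. code (1 / 2 ^ k) x = c k"
  obtains x where "x \<in> C" "\<And>k. d (y (c k)) x \<le> 1 / 2 ^ k"
proof -
  let ?z = "\<lambda>k. y (c k)"
  have near: "d (?z k) (?z k') < 1 / 2 ^ k + 1 / 2 ^ k'" for k k'
  proof -
    obtain x where x: "x \<in> C" "\<And>i. i < Suc (max k k') \<Longrightarrow> code (1 / 2 ^ i) x = c i"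
      using c[of "Suc (max k k')"] by blast
    then have "d x (?z k) < 1 / 2 ^ k" "d x (?z k') < 1 / 2 ^ k'"
      using dist_code[OF x(1), of "1 / 2 ^ k"] dist_code[OF x(1), of "1 / 2 ^ k'"]
        x(2)[of k] x(2)[of k'] by auto
    then show ?thesis
      using triangle[of "?z k" x "?z k'"] x(1) core_subset commute[of x "?z k"] by auto
  qed
  have "MCauchy ?z"
    unfolding MCauchy_def
  proof (intro conjI allI impI)
    fix e :: real assume "0 < e"
    then obtain N where N: "(1 / 2 :: real) ^ N < e / 2"
      using real_arch_pow_inv[of "e / 2" "1 / 2"] by auto
    have "d (?z n) (?z n') < e" if "N \<le> n" "N \<le> n'" for n n'
    proof -
      have "(1 / 2 :: real) ^ n \<le> (1 / 2) ^ N" "(1 / 2 :: real) ^ n' \<le> (1 / 2) ^ N"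
        using that by (auto intro: power_decreasing)
      with near[of n n'] N show ?thesis by (simp add: power_one_over)
    qed
    then show "\<exists>N. \<forall>n n'. N \<le> n \<longrightarrow> N \<le> n' \<longrightarrow> d (?z n) (?z n') < e" by blast
  qed auto
  then obtain x where x: "x \<in> C" "limitin mtopology ?z x sequentially"
    using core_complete[of ?z] y_in by blast
  then have xM: "x \<in> M" and lim: "(\<lambda>k. d (?z k) x) \<longlonglongrightarrow> 0"
    using core_subset by (auto simp: limitin_metric_dist_null)
  have "d (?z k) x \<le> 1 / 2 ^ k" for k
  proof (rule LIMSEQ_le_const)
    show "(\<lambda>k'. (1 / 2 ^ k + (1 / 2) ^ k') + d (?z k') x) \<longlonglongrightarrow> 1 / 2 ^ k"
      using tendsto_add[OF tendsto_add[OF tendsto_const LIMSEQ_power_zero] lim, of "1 / 2" "1 / 2 ^ k"]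
      by simp
    show "\<exists>N. \<forall>k'\<ge>N. d (?z k) x \<le> (1 / 2 ^ k + (1 / 2) ^ k') + d (?z k') x"
      using triangle[of "?z k" "?z _" x] near[of k] xM
      by (intro exI allI impI) (smt (verit) y_in_M power_one_over)
  qed
  with x(1) show thesis by (rule that)
qed

text \<open>The approximations \<open>y (e k w)\<close> of \<open>Y w\<close> take countably many values. They are part of the
  conclusion because any function of \<open>Y\<close> that is continuous on \<open>M\<close> is the limit of its values at
  them, and thereby measurable.\<close>
theorem cauchy_laws_converge:
  fixes Z :: "nat \<Rightarrow> 'v \<Rightarrow> 'a"
  assumes Q: "\<And>m. prob_space (Q m)"
    and Z: "\<And>m. Z m \<in> Q m \<rightarrow>\<^sub>M A" and Z_C: "\<And>m w. w \<in> space (Q m) \<Longrightarrow> Z m w \<in> C"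
    and \<delta>: "\<delta> \<longlonglongrightarrow> 0"
    and close: "\<And>L g m m'. test_fun L g \<Longrightarrow> m \<le> m' \<Longrightarrow>
      \<bar>(\<integral>w. g (Z m w) \<partial>Q m) - (\<integral>w. g (Z m' w) \<partial>Q m')\<bar> \<le> L * \<delta> m"
  obtains R :: "(nat list \<Rightarrow> nat) measure" and e Y
  where "prob_space R" "\<And>k. e k \<in> R \<rightarrow>\<^sub>M count_space UNIV"
    "\<And>w. w \<in> space R \<Longrightarrow> Y w \<in> C"
    "\<And>w k. w \<in> space R \<Longrightarrow> d (y (e k w)) (Y w) \<le> 1 / 2 ^ k"
    "\<And>L g. test_fun L g \<Longrightarrow> (\<lambda>m. \<integral>w. g (Z m w) \<partial>Q m) \<longlonglongrightarrow> (\<integral>w. g (Y w) \<partial>R)"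
proof -
  let ?W = "\<lambda>m k w. code (1 / 2 ^ k) (Z m w)"
  have W: "?W m k \<in> Q m \<rightarrow>\<^sub>M count_space UNIV" for m k
    by (rule measurable_compose[OF Z code_measurable])
  have tight: "\<exists>N. \<forall>m. measure (Q m) {w \<in> space (Q m). N \<le> ?W m k w} \<le> \<epsilon>" if "0 < \<epsilon>" for k \<epsilon>
    by (rule uniform_tightness[OF Q Z Z_C \<delta> close]) (use that in auto)
  obtain r :: "nat \<Rightarrow> nat" and R :: "(nat list \<Rightarrow> nat) measure" and c
    where r: "strict_mono r" and R: "prob_space R" and c: "\<And>k. c k \<in> R \<rightarrow>\<^sub>M count_space UNIV"
      and c_lim: "\<And>s. (\<lambda>j. measure (Q (r j)) {w \<in> space (Q (r j)). \<forall>k<length s. ?W (r j) k w = s ! k})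
        \<longlonglongrightarrow> measure R {w \<in> space R. \<forall>k<length s. c k w = s ! k}"
    by (rule tight_nat_sequences_subsequence[where Q = Q and W = ?W, OF Q W tight]) (assumption, rule that)
  interpret R: prob_space R by (rule R)
  have [measurable]: "Measurable.pred R (\<lambda>w. P (c k w))" for P k
    by (rule measurable_compose[OF c]) simp
  define compatible where "compatible s \<longleftrightarrow> (\<exists>x\<in>C. \<forall>k<length s. code (1 / 2 ^ k) x = s ! k)" for s
  have "AE w in R. \<not> (\<forall>k<length s. c k w = s ! k)" if "\<not> compatible s" for s
  proof -
    have "{w \<in> space (Q m). \<forall>k<length s. ?W m k w = s ! k} = {}" for m
      using that Z_C by (auto simp: compatible_def)
    with c_lim[of s] have "measure R {w \<in> space R. \<forall>k<length s. c k w = s ! k} = 0"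
      by (simp add: LIMSEQ_const_iff)
    then show ?thesis
      by (intro AE_I[where N = "{w \<in> space R. \<forall>k<length s. c k w = s ! k}"])
         (auto simp: R.emeasure_eq_measure)
  qed
  then have "AE w in R. \<forall>s. \<not> compatible s \<longrightarrow> \<not> (\<forall>k<length s. c k w = s ! k)"
    unfolding AE_all_countable by auto
  then obtain N where N: "N \<in> null_sets R"
    and N_compat: "\<And>w s. w \<in> space R \<Longrightarrow> w \<notin> N \<Longrightarrow> (\<forall>k<length s. c k w = s ! k) \<Longrightarrow> compatible s"
    by (elim AE_E) (auto simp: null_sets_def)
  have N_sets: "N \<in> sets R" using N by auto
  \<comment> \<open>on the null set the constant code \<open>0\<close> names the constant sequence \<open>y 0\<close>\<close>
  define e where "e k w = (if w \<in> N then 0 else c k w)" for k w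
  have e: "e k \<in> R \<rightarrow>\<^sub>M count_space UNIV" for k
    unfolding e_def by (intro measurable_If_set c N_sets) (auto simp: N_sets)
  have "\<exists>x. x \<in> C \<and> (\<forall>k. d (y (e k w)) x \<le> 1 / 2 ^ k)" if w: "w \<in> space R" for w
  proof (cases "w \<in> N")
    case True
    then show ?thesis by (intro exI[of _ "y 0"]) (auto simp: e_def y_in)
  next
    case False
    have "\<exists>x\<in>C. \<forall>k<n. code (1 / 2 ^ k) x = e k w" for n
      using N_compat[OF w False, of "map (\<lambda>k. c k w) [0..<n]"] False
      by (auto simp: compatible_def e_def)
    then show ?thesis by (rule compatible_codes_converge[of "\<lambda>k. e k w"]) blast
  qed
  then obtain Y where Y_C: "\<And>w. w \<in> space R \<Longrightarrow> Y w \<in> C"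
    and Y_near: "\<And>w k. w \<in> space R \<Longrightarrow> d (y (e k w)) (Y w) \<le> 1 / 2 ^ k"
    by metis
  have Y_M: "Y w \<in> M" if "w \<in> space R" for w using Y_C[OF that] core_subset by blast
  have lim: "(\<lambda>m. \<integral>w. g (Z m w) \<partial>Q m) \<longlonglongrightarrow> (\<integral>w. g (Y w) \<partial>R)" if g: "test_fun L g" for L g
  proof -
    obtain B where B: "0 \<le> B" "\<And>x. x \<in> M \<Longrightarrow> \<bar>g x\<bar> \<le> B" using g by (rule test_fun_bound) blast
    note L = test_fun_nonneg[OF g] and lip = test_fun_lipschitz[OF g]
    have ge: "(\<lambda>w. g (y (e k w))) \<in> borel_measurable R" for k
      by (rule measurable_compose[OF e]) simp
    have ge_near: "\<bar>g (y (e k w)) - g (Y w)\<bar> \<le> L / 2 ^ k" if "w \<in> space R" for k w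
      using lip[OF y_in_M Y_M[OF that], of "e k w"] mult_left_mono[OF Y_near[OF that, of k] L]
      by simp
    have gY: "(\<lambda>w. g (Y w)) \<in> borel_measurable R"
    proof (rule borel_measurable_LIMSEQ_real[OF _ ge])
      fix w assume w: "w \<in> space R"
      have "(\<lambda>k. L * (1 / 2) ^ k) \<longlonglongrightarrow> 0"
        by (intro tendsto_mult_right_zero LIMSEQ_power_zero) simp
      then have "(\<lambda>k. g (y (e k w)) - g (Y w)) \<longlonglongrightarrow> 0"
        by (rule Lim_null_comparison[rotated]) (use ge_near[OF w] in \<open>auto simp: power_one_over\<close>)
      then show "(\<lambda>k. g (y (e k w))) \<longlonglongrightarrow> g (Y w)"
        by (simp add: LIM_zero_iff)
    qed
    have int_e: "integrable R (\<lambda>w. g (y (e k w)))" for k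
      using B by (intro R.integrable_const_bound[where B = B] ge) auto
    have int_Y: "integrable R (\<lambda>w. g (Y w))"
      using B Y_M by (intro R.integrable_const_bound[where B = B] gY) auto
    have err_Y: "\<bar>(\<integral>w. g (y (e k w)) \<partial>R) - (\<integral>w. g (Y w) \<partial>R)\<bar> \<le> L / 2 ^ k" for k
    proof -
      have "\<bar>(\<integral>w. g (y (e k w)) \<partial>R) - (\<integral>w. g (Y w) \<partial>R)\<bar> = \<bar>\<integral>w. g (y (e k w)) - g (Y w) \<partial>R\<bar>"
        by (simp add: int_e int_Y)
      also have "\<dots> \<le> (\<integral>w. \<bar>g (y (e k w)) - g (Y w)\<bar> \<partial>R)"
        by (rule integral_abs_bound)
      also have "\<dots> \<le> (\<integral>w. L / 2 ^ k \<partial>R)"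
        by (intro integral_mono ge_near) (auto simp: int_e int_Y)
      finally show ?thesis by (simp add: R.prob_space)
    qed
    have err_Z: "\<bar>(\<integral>w. g (y (?W m k w)) \<partial>Q m) - (\<integral>w. g (Z m w) \<partial>Q m)\<bar> \<le> L / 2 ^ k" for m k
    proof -
      interpret Q: prob_space "Q m" by (rule Q)
      have int_Z: "integrable (Q m) (\<lambda>w. g (Z m w))"
        by (rule test_fun_integrable[OF g Q Z])
      have int_W: "integrable (Q m) (\<lambda>w. g (y (?W m k w)))"
        using B by (intro Q.integrable_const_bound[where B = B] measurable_compose[OF W]) auto
      have near: "\<bar>g (y (?W m k w)) - g (Z m w)\<bar> \<le> L / 2 ^ k" if "w \<in> space (Q m)" for w
      proof -
        have "Z m w \<in> C" by (rule Z_C[OF that])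
        then have "d (Z m w) (y (?W m k w)) \<le> 1 / 2 ^ k" "Z m w \<in> M"
          using dist_code[of "Z m w" "1 / 2 ^ k"] core_subset by auto
        from mult_left_mono[OF this(1) L] lip[OF y_in_M this(2), of "?W m k w"]
        show ?thesis by (simp add: commute)
      qed
      have "\<bar>(\<integral>w. g (y (?W m k w)) \<partial>Q m) - (\<integral>w. g (Z m w) \<partial>Q m)\<bar>
          = \<bar>\<integral>w. g (y (?W m k w)) - g (Z m w) \<partial>Q m\<bar>"
        by (simp add: int_W int_Z)
      also have "\<dots> \<le> (\<integral>w. \<bar>g (y (?W m k w)) - g (Z m w)\<bar> \<partial>Q m)"
        by (rule integral_abs_bound)
      also have "\<dots> \<le> (\<integral>w. L / 2 ^ k \<partial>Q m)"
        by (intro integral_mono near) (auto simp: int_W int_Z)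
      finally show ?thesis by (simp add: Q.prob_space)
    qed
    \<comment> \<open>the letter at position \<open>k\<close> is a function of the prefix of length \<open>k + 1\<close>,
      whose law converges\<close>
    have codes: "(\<lambda>j. \<integral>w. g (y (?W (r j) k w)) \<partial>Q (r j)) \<longlonglongrightarrow> (\<integral>w. g (y (e k w)) \<partial>R)" for k
    proof -
      have prefix_eq: "{w \<in> space N. map (\<lambda>i. f i w) [0..<Suc k] = s} =
          (if length s = Suc k then {w \<in> space N. \<forall>i<length s. f i w = s ! i} else {})"
        for f :: "nat \<Rightarrow> 'u \<Rightarrow> nat" and N :: "'u measure" and s
        by (auto simp: list_eq_iff_nth_eq nth_append less_Suc_eq simp del: upt_Suc)
      have prefix_meas: "(\<lambda>w. map (\<lambda>i. f i w) [0..<Suc k]) \<in> N \<rightarrow>\<^sub>M count_space UNIV"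
        if f: "\<And>i. f i \<in> N \<rightarrow>\<^sub>M count_space UNIV" for f :: "nat \<Rightarrow> 'u \<Rightarrow> nat" and N :: "'u measure"
      proof -
        have [measurable]: "Measurable.pred N (\<lambda>w. P (f i w))" for P i
          by (rule measurable_compose[OF f]) simp
        have "{w \<in> space N. map (\<lambda>i. f i w) [0..<Suc k] = s} \<in> sets N" for s
          unfolding prefix_eq by simp
        then show ?thesis
          by (intro measurable_count_space_eq2_countable[THEN iffD2])
             (auto simp: vimage_def Int_def conj_commute simp del: upt_Suc)
      qed
      have same: "measure R {w \<in> space R. \<forall>i<length s. e i w = s ! i}
          = measure R {w \<in> space R. \<forall>i<length s. c i w = s ! i}" for s
      proof (rule R.finite_measure_eq_AE)
        show "AE w in R. (w \<in> {w \<in> space R. \<forall>i<length s. e i w = s ! i})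
            = (w \<in> {w \<in> space R. \<forall>i<length s. c i w = s ! i})"
          using AE_not_in[OF N] by eventually_elim (simp add: e_def)
        have [measurable]: "Measurable.pred R (\<lambda>w. P (e i w))" for P i
          by (rule measurable_compose[OF e]) simp
        show "{w \<in> space R. \<forall>i<length s. e i w = s ! i} \<in> sets R" by measurable
      qed measurable
      have "(\<lambda>j. \<integral>w. g (y (map (\<lambda>i. ?W (r j) i w) [0..<Suc k] ! k)) \<partial>Q (r j))
          \<longlonglongrightarrow> (\<integral>w. g (y (map (\<lambda>i. e i w) [0..<Suc k] ! k)) \<partial>R)"
      proof (rule countable_valued_expectation_convergence[where h = "\<lambda>s. g (y (s ! k))" and B = B])
        show "(\<lambda>j. measure (Q (r j)) {w \<in> space (Q (r j)). map (\<lambda>i. ?W (r j) i w) [0..<Suc k] = s})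
            \<longlonglongrightarrow> measure R {w \<in> space R. map (\<lambda>i. e i w) [0..<Suc k] = s}" for s
        proof (cases "length s = Suc k")
          case True
          then show ?thesis using c_lim[of s] same[of s] by (simp only: prefix_eq if_P)
        qed (simp add: prefix_eq del: upt_Suc)
        show "(\<lambda>w. map (\<lambda>i. ?W (r j) i w) [0..<Suc k]) \<in> Q (r j) \<rightarrow>\<^sub>M count_space UNIV" for j
          by (rule prefix_meas) (rule W)
        show "(\<lambda>w. map (\<lambda>i. e i w) [0..<Suc k]) \<in> R \<rightarrow>\<^sub>M count_space UNIV"
          by (rule prefix_meas) (rule e)
      qed (use Q R B in auto)
      then show ?thesis by (simp add: nth_append del: upt_Suc)
    qed
    \<comment> \<open>replacing a point by the one that its \<open>k\<close>-th letter names costs at most \<open>L / 2 ^ k\<close>,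
      both for the \<open>Z m\<close> and in the limit\<close>
    have sub: "(\<lambda>j. \<integral>w. g (Z (r j) w) \<partial>Q (r j)) \<longlonglongrightarrow> (\<integral>w. g (Y w) \<partial>R)"
    proof (rule LIMSEQ_I)
      fix \<epsilon> :: real assume \<epsilon>: "0 < \<epsilon>"
      have "(\<lambda>k. L * (1 / 2) ^ k) \<longlonglongrightarrow> 0"
        by (intro tendsto_mult_right_zero LIMSEQ_power_zero) simp
      then have "\<forall>\<^sub>F k in sequentially. L * (1 / 2) ^ k < \<epsilon> / 3"
        by (rule order_tendstoD) (use \<epsilon> in simp)
      then obtain k where k: "L / 2 ^ k < \<epsilon> / 3"
        by (auto simp: eventually_sequentially power_one_over)
      obtain j0 where j0: "\<And>j. j0 \<le> j \<Longrightarrow>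
          norm ((\<integral>w. g (y (?W (r j) k w)) \<partial>Q (r j)) - (\<integral>w. g (y (e k w)) \<partial>R)) < \<epsilon> / 3"
        using LIMSEQ_D[OF codes[of k], of "\<epsilon> / 3"] \<epsilon> by auto
      have "norm ((\<integral>w. g (Z (r j) w) \<partial>Q (r j)) - (\<integral>w. g (Y w) \<partial>R)) < \<epsilon>" if "j0 \<le> j" for j
        using j0[OF that] err_Y[of k] err_Z[of "r j" k] k unfolding real_norm_def by linarith
      then show "\<exists>j0. \<forall>j\<ge>j0. norm ((\<integral>w. g (Z (r j) w) \<partial>Q (r j)) - (\<integral>w. g (Y w) \<partial>R)) < \<epsilon>"
        by blast
    qed
    \<comment> \<open>the Cauchy condition extends the convergence from the subsequence to all \<open>m\<close>\<close>
    have "\<bar>(\<integral>w. g (Z m w) \<partial>Q m) - (\<integral>w. g (Y w) \<partial>R)\<bar> \<le> L * \<delta> m" for m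
    proof (rule LIMSEQ_le_const2)
      show "(\<lambda>j. \<bar>(\<integral>w. g (Z m w) \<partial>Q m) - (\<integral>w. g (Z (r j) w) \<partial>Q (r j))\<bar>)
          \<longlonglongrightarrow> \<bar>(\<integral>w. g (Z m w) \<partial>Q m) - (\<integral>w. g (Y w) \<partial>R)\<bar>"
        by (intro tendsto_intros sub)
      show "\<exists>N. \<forall>j\<ge>N. \<bar>(\<integral>w. g (Z m w) \<partial>Q m) - (\<integral>w. g (Z (r j) w) \<partial>Q (r j))\<bar> \<le> L * \<delta> m"
        using close[OF g] seq_suble[OF r] by (meson order_trans)
    qed
    moreover have "(\<lambda>m. L * \<delta> m) \<longlonglongrightarrow> 0"
      by (intro tendsto_mult_right_zero \<delta>)
    ultimately have "(\<lambda>m. (\<integral>w. g (Z m w) \<partial>Q m) - (\<integral>w. g (Y w) \<partial>R)) \<longlonglongrightarrow> 0"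
      by (intro Lim_null_comparison[OF _ \<open>(\<lambda>m. L * \<delta> m) \<longlonglongrightarrow> 0\<close>]) auto
    then show ?thesis by (simp add: LIM_zero_iff)
  qed
  show thesis by (rule that[OF R e Y_C Y_near lim])
qed

end

section \<open>Spaces of paths on the cube\<close>

text \<open>Every point of the cube, including those on its upper faces, is a limit of points of this
  countable set from above, and cadlag functions are continuous from above. So suprema over the cube are
  suprema over this set, and thereby measurable.\<close>
definition rational_grid :: "(real^'d::finite) set" where
  "rational_grid = {t \<in> cube. \<forall>i. t $ i \<in> \<rat>}"

lemma countable_rational_grid: "countable (rational_grid :: (real^'d::finite) set)"
proof -
  have "rational_grid \<subseteq> range (\<lambda>q :: 'd \<Rightarrow> rat. \<chi> i. real_of_rat (q i))"
  proof
    fix t :: "real^'d" assume "t \<in> rational_grid"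
    then have "\<forall>i. \<exists>q. t $ i = real_of_rat q" by (auto simp: rational_grid_def Rats_def)
    then obtain q where "\<And>i. t $ i = real_of_rat (q i)" by metis
    then have "t = (\<chi> i. real_of_rat (q i))" by (simp add: vec_eq_iff)
    then show "t \<in> range (\<lambda>q :: 'd \<Rightarrow> rat. \<chi> i. real_of_rat (q i))" by blast
  qed
  then show ?thesis by (rule countable_subset) auto
qed

lemma rational_grid_subset: "rational_grid \<subseteq> cube"
  by (auto simp: rational_grid_def)

lemma rational_grid_approximates_from_above:
  fixes t :: "real^'d::finite"
  assumes t: "t \<in> cube" and e: "0 < e"
  obtains s where "s \<in> rational_grid" "s \<in> quadrant {} t" "dist s t < e"
proof -
  define \<eta> where "\<eta> = e / (2 * real CARD('d))"
  have \<eta>: "0 < \<eta>" using e by (simp add: \<eta>_def)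
  have "\<exists>q. q \<in> \<rat> \<and> t $ i \<le> q \<and> q \<le> 1 \<and> q \<le> t $ i + \<eta>" for i
  proof (cases "t $ i = 1")
    case True
    then show ?thesis using \<eta> by (intro exI[of _ 1]) auto
  next
    case False
    then have "t $ i < min 1 (t $ i + \<eta>)" using t \<eta> by (auto simp: mem_box_cart order_less_le)
    from Rats_dense_in_real[OF this] show ?thesis by (auto intro: less_imp_le)
  qed
  then obtain q where q: "\<And>i. q i \<in> \<rat>" "\<And>i. t $ i \<le> q i" "\<And>i. q i \<le> 1" "\<And>i. q i \<le> t $ i + \<eta>"
    by metis
  define s :: "real^'d" where "s = (\<chi> i. q i)"
  have s_cube: "s \<in> cube"
    using t q order_trans by (auto simp: s_def mem_box_cart) blast
  have "norm (s - t) \<le> (\<Sum>i\<in>UNIV. \<bar>(s - t) $ i\<bar>)" by (rule norm_le_l1_cart)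
  also have "\<dots> \<le> (\<Sum>i\<in>(UNIV :: 'd set). \<eta>)"
  proof (rule sum_mono)
    show "\<bar>(s - t) $ i\<bar> \<le> \<eta>" for i using q(2,4)[of i] by (simp add: s_def)
  qed
  also have "\<dots> < e" using e by (simp add: \<eta>_def)
  finally have "dist s t < e" by (simp add: dist_norm)
  moreover have "s \<in> rational_grid" "s \<in> quadrant {} t"
    using s_cube q by (auto simp: rational_grid_def quadrant_def s_def)
  ultimately show thesis using that by blast
qed

lemma right_continuous_bound_from_rational_grid:
  fixes z :: "real^'d::finite \<Rightarrow> real"
  assumes z: "(z \<longlongrightarrow> z t) (at t within quadrant {} t)" and t: "t \<in> cube"
    and b: "\<And>s. s \<in> rational_grid \<Longrightarrow> \<bar>z s\<bar> \<le> b"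
  shows "\<bar>z t\<bar> \<le> b"
proof (rule ccontr)
  assume "\<not> \<bar>z t\<bar> \<le> b"
  moreover have "((\<lambda>s. \<bar>z s\<bar>) \<longlongrightarrow> \<bar>z t\<bar>) (at t within quadrant {} t)"
    using z by (rule tendsto_rabs)
  ultimately have "\<forall>\<^sub>F s in at t within quadrant {} t. b < \<bar>z s\<bar>"
    by (intro order_tendstoD) auto
  then obtain e where e: "0 < e" "\<And>s. s \<in> quadrant {} t \<Longrightarrow> s \<noteq> t \<Longrightarrow> dist s t < e \<Longrightarrow> b < \<bar>z s\<bar>"
    by (auto simp: eventually_at)
  obtain s where "s \<in> rational_grid" "s \<in> quadrant {} t" "dist s t < e"
    using rational_grid_approximates_from_above[OF t e(1)] .
  then show False using e(2)[of s] b[of s] \<open>\<not> \<bar>z t\<bar> \<le> b\<close> by (cases "s = t") auto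
qed

lemma D_paths_right_continuous:
  "x \<in> D_paths \<Longrightarrow> t \<in> cube \<Longrightarrow> (x \<longlongrightarrow> x t) (at t within quadrant {} t)"
  by (auto simp: D_paths_def cadlag_def)

lemma sup_dist_le_iff_rational_grid:
  assumes "x \<in> D_paths" "x' \<in> D_paths"
  shows "sup_dist x x' \<le> b \<longleftrightarrow> (\<forall>t\<in>rational_grid. \<bar>x t - x' t\<bar> \<le> b)"
proof
  assume grid: "\<forall>t\<in>rational_grid. \<bar>x t - x' t\<bar> \<le> b"
  have "\<bar>x t - x' t\<bar> \<le> b" if t: "t \<in> cube" for t
    using right_continuous_bound_from_rational_grid[of "\<lambda>t. x t - x' t", OF _ t]
      tendsto_diff[OF D_paths_right_continuous[OF assms(1) t] D_paths_right_continuous[OF assms(2) t]]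
      grid by simp
  then show "sup_dist x x' \<le> b" by (simp add: sup_dist_le_iff[OF assms])
qed (use rational_grid_subset in \<open>auto simp: sup_dist_le_iff[OF assms]\<close>)

lemma sup_norm_eq_SUP_rational_grid:
  fixes x :: "('d::finite) path"
  assumes "x \<in> D_paths" shows "sup_norm x = (SUP t\<in>rational_grid. ennreal \<bar>x t\<bar>)"
proof (rule antisym)
  let ?S = "SUP t\<in>rational_grid. ennreal \<bar>x t\<bar>"
  show "?S \<le> sup_norm x"
    unfolding sup_norm_def by (rule SUP_subset_mono[OF rational_grid_subset]) simp
  show "sup_norm x \<le> ?S"
    unfolding sup_norm_def
  proof (rule SUP_least)
    fix t :: "real^'d" assume t: "t \<in> cube"
    show "ennreal \<bar>x t\<bar> \<le> ?S"
    proof (cases ?S)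
      case (real b)
      have "\<bar>x s\<bar> \<le> b" if "s \<in> rational_grid" for s
      proof -
        have "ennreal \<bar>x s\<bar> \<le> ennreal b" using SUP_upper[OF that] real(2) by metis
        with real(1) show ?thesis by simp
      qed
      then have "\<bar>x t\<bar> \<le> b"
        by (rule right_continuous_bound_from_rational_grid[OF D_paths_right_continuous[OF assms t] t])
      then show ?thesis unfolding real(2) by (rule ennreal_leI)
    next
      case top
      show ?thesis unfolding top by (rule top_greatest)
    qed
  qed
qed

lemma D_paths_extensional: "D_paths \<subseteq> extensional cube"
  by (auto simp: D_paths_def)

lemma C_paths_extensional: "C_paths \<subseteq> extensional cube"
  by (auto simp: C_paths_def)

lemma measurable_path_space_subset:
  assumes "S \<subseteq> S'" "S' \<subseteq> extensional cube" "X \<in> N \<rightarrow>\<^sub>M path_space S"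
  shows "X \<in> N \<rightarrow>\<^sub>M path_space S'"
  using assms(3) assms(1)
  unfolding measurable_path_space_iff[OF assms(2)] measurable_path_space_iff[OF order_trans[OF assms(1,2)]]
  by auto

lemma measurable_path_spaceD:
  assumes "X \<in> N \<rightarrow>\<^sub>M path_space S" "S \<subseteq> extensional cube"
  shows "w \<in> space N \<Longrightarrow> X w \<in> S" "t \<in> cube \<Longrightarrow> (\<lambda>w. X w t) \<in> borel_measurable N"
  using assms(1) unfolding measurable_path_space_iff[OF assms(2)] by auto

lemma space_path_space: "S \<subseteq> extensional cube \<Longrightarrow> space (path_space S) = S"
  by (auto simp: path_space_def space_restrict_space space_PiM PiE_def)

lemma measurable_sup_dist:
  assumes X: "X \<in> N \<rightarrow>\<^sub>M path_space D_paths" and X': "X' \<in> N \<rightarrow>\<^sub>M path_space D_paths"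
  shows "(\<lambda>w. sup_dist (X w) (X' w)) \<in> borel_measurable N"
  unfolding borel_measurable_iff_le
proof
  fix b
  have D: "X w \<in> D_paths" "X' w \<in> D_paths" if "w \<in> space N" for w
    using measurable_path_spaceD(1)[OF X D_paths_extensional that]
      measurable_path_spaceD(1)[OF X' D_paths_extensional that] .
  have [measurable]: "(\<lambda>w. X w t) \<in> borel_measurable N" "(\<lambda>w. X' w t) \<in> borel_measurable N"
    if "t \<in> rational_grid" for t
    using measurable_path_spaceD(2)[OF X D_paths_extensional] that rational_grid_subset
      measurable_path_spaceD(2)[OF X' D_paths_extensional] by auto
  have "{w \<in> space N. sup_dist (X w) (X' w) \<le> b}
      = {w \<in> space N. \<forall>t\<in>rational_grid. \<bar>X w t - X' w t\<bar> \<le> b}"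
    by (rule Collect_cong) (auto simp: sup_dist_le_iff_rational_grid[OF D])
  also have "\<dots> \<in> sets N"
    by (rule sets.sets_Collect_countable_All'[OF _ countable_rational_grid]) measurable
  finally show "{w \<in> space N. sup_dist (X w) (X' w) \<le> b} \<in> sets N" .
qed

lemma measurable_sup_norm:
  assumes X: "X \<in> N \<rightarrow>\<^sub>M path_space D_paths"
  shows "(\<lambda>w. sup_norm (X w)) \<in> borel_measurable N"
proof -
  have ev: "(\<lambda>w. X w t) \<in> borel_measurable N" if "t \<in> rational_grid" for t
    using measurable_path_spaceD(2)[OF X D_paths_extensional] that rational_grid_subset by auto
  have "(\<lambda>w. ennreal \<bar>X w t\<bar>) \<in> borel_measurable N" if "t \<in> rational_grid" for t
    using ev[OF that] by measurable
  then have "(\<lambda>w. SUP t\<in>rational_grid. ennreal \<bar>X w t\<bar>) \<in> borel_measurable N"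
    by (rule borel_measurable_SUP[OF countable_rational_grid])
  moreover have "sup_norm (X w) = (SUP t\<in>rational_grid. ennreal \<bar>X w t\<bar>)" if "w \<in> space N" for w
    by (rule sup_norm_eq_SUP_rational_grid[OF measurable_path_spaceD(1)[OF X D_paths_extensional that]])
  ultimately show ?thesis by (subst measurable_cong) auto
qed

text \<open>A continuous path is determined up to \<open>3 / (n + 1)\<close> by a modulus of continuity and by its
  values on a finite net, rounded to multiples of \<open>1 / (n + 1)\<close>. There are countably many such
  descriptions, and the dense sequence picks one path for each description that fits any.\<close>
lemma C_paths_separable:
  obtains y :: "nat \<Rightarrow> ('d::finite) path"
  where "\<And>i. y i \<in> C_paths" "\<And>x e. x \<in> C_paths \<Longrightarrow> 0 < e \<Longrightarrow> \<exists>i. sup_dist x (y i) < e"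
proof -
  have "\<exists>(N::nat) h. (\<forall>i. h i \<in> cube) \<and>
      (\<forall>t\<in>(cube :: (real^'d) set). \<exists>i<N. dist t (h i) < inverse (real (Suc k)))" for k :: nat
  proof -
    have "0 < inverse (real (Suc k))" by simp
    then obtain N :: nat and h :: "nat \<Rightarrow> real^'d"
      where "\<And>i. h i \<in> cube" "\<And>t. t \<in> cube \<Longrightarrow> \<exists>i<N. dist t (h i) < inverse (real (Suc k))"
      by (rule finite_net_cube) blast
    then show ?thesis by blast
  qed
  then obtain N :: "nat \<Rightarrow> nat" and h :: "nat \<Rightarrow> nat \<Rightarrow> real^'d"
    where h: "\<And>k i. h k i \<in> cube"
      and net: "\<And>k t. t \<in> cube \<Longrightarrow> \<exists>i<N k. dist t (h k i) < inverse (real (Suc k))"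
    by metis
  define described where "described x k n v \<longleftrightarrow> x \<in> C_paths \<and>
      (\<forall>s\<in>cube. \<forall>t\<in>cube. dist s t < inverse (real (Suc k)) \<longrightarrow> \<bar>x s - x t\<bar> \<le> 1 / real (Suc n)) \<and>
      v = map (\<lambda>i. \<lfloor>real (Suc n) * x (h k i)\<rfloor>) [0..<N k]"
    for x :: "'d path" and k n :: nat and v :: "int list"
  define z :: "'d path" where "z = restrict (\<lambda>_. 0) cube"
  have z: "z \<in> C_paths"
    unfolding C_paths_def z_def by (auto intro: continuous_on_eq[of _ "\<lambda>_. 0"])
  define pick where "pick = (\<lambda>(k, n, v). if \<exists>x. described x k n v then SOME x. described x k n v else z)"
  have pick: "described (pick (k, n, v)) k n v" if "described x k n v" for x k n v
    using that someI[of "\<lambda>x. described x k n v" x] by (auto simp: pick_def)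
  have pick_C: "pick key \<in> C_paths" for key
  proof -
    obtain k n v where key: "key = (k, n, v)" by (cases key)
    show ?thesis
    proof (cases "\<exists>x. described x k n v")
      case True
      then obtain x where "described x k n v" by blast
      from pick[OF this] show ?thesis unfolding key by (simp only: described_def)
    next
      case False
      with z show ?thesis by (simp add: key pick_def)
    qed
  qed
  have close: "sup_dist x x' \<le> 3 / real (Suc n)" if "described x k n v" "described x' k n v" for x x' k n v
  proof -
    have D: "x \<in> D_paths" "x' \<in> D_paths"
      using that[unfolded described_def] C_paths_subset_D_paths by blast+
    show ?thesis
      unfolding sup_dist_le_iff[OF D]
    proof
      fix t :: "real^'d" assume t: "t \<in> cube"
      then obtain i where i: "i < N k" "dist t (h k i) < inverse (real (Suc k))" using net by blast
      have near: "\<bar>x t - x (h k i)\<bar> \<le> 1 / real (Suc n)" "\<bar>x' t - x' (h k i)\<bar> \<le> 1 / real (Suc n)"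
        using that[unfolded described_def] t h[of k i] i(2) by simp_all
      have "v = map (\<lambda>i. \<lfloor>real (Suc n) * x (h k i)\<rfloor>) [0..<N k]"
        using that(1)[unfolded described_def] by (elim conjE)
      moreover have "v = map (\<lambda>i. \<lfloor>real (Suc n) * x' (h k i)\<rfloor>) [0..<N k]"
        using that(2)[unfolded described_def] by (elim conjE)
      ultimately have "v ! i = \<lfloor>real (Suc n) * x (h k i)\<rfloor>" "v ! i = \<lfloor>real (Suc n) * x' (h k i)\<rfloor>"
        using i(1) by simp_all
      then have "\<lfloor>real (Suc n) * x (h k i)\<rfloor> = \<lfloor>real (Suc n) * x' (h k i)\<rfloor>"
        by simp
      then have "\<bar>real (Suc n) * x (h k i) - real (Suc n) * x' (h k i)\<bar> \<le> 1"
        by linarith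
      then have "real (Suc n) * \<bar>x (h k i) - x' (h k i)\<bar> \<le> 1"
        by (simp only: right_diff_distrib[symmetric] abs_mult abs_of_nat)
      then have "\<bar>x (h k i) - x' (h k i)\<bar> \<le> 1 / real (Suc n)"
        by (simp add: pos_le_divide_eq mult.commute)
      with near have "\<bar>x t - x' t\<bar> \<le> 1 / real (Suc n) + 1 / real (Suc n) + 1 / real (Suc n)"
        by linarith
      then show "\<bar>x t - x' t\<bar> \<le> 3 / real (Suc n)" by simp
    qed
  qed
  show thesis
  proof (rule that[of "\<lambda>i. pick (from_nat i)"])
    show "pick (from_nat i) \<in> C_paths" for i by (rule pick_C)
    show "\<exists>i. sup_dist x (pick (from_nat i)) < e" if x: "x \<in> C_paths" and e: "0 < e" for x e
    proof -
      obtain n where "inverse (real (Suc n)) < e / 3"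
        using reals_Archimedean[of "e / 3"] e by auto
      then have n: "3 / real (Suc n) < e" by (simp add: field_simps)
      have "uniformly_continuous_on cube x"
        using x by (intro compact_uniformly_continuous) (auto simp: C_paths_def)
      moreover have "0 < 1 / real (Suc n)" by simp
      ultimately obtain \<delta> where \<delta>: "0 < \<delta>"
        "\<And>s t. s \<in> cube \<Longrightarrow> t \<in> cube \<Longrightarrow> dist s t < \<delta> \<Longrightarrow> dist (x s) (x t) < 1 / real (Suc n)"
        unfolding uniformly_continuous_on_def by metis
      obtain k where k: "inverse (real (Suc k)) < \<delta>"
        using reals_Archimedean[OF \<delta>(1)] by blast
      have mod: "\<bar>x s - x t\<bar> \<le> 1 / real (Suc n)"
        if "s \<in> cube" "t \<in> cube" "dist s t < inverse (real (Suc k))" for s t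
        using \<delta>(2)[of s t] that k unfolding dist_real_def by linarith
      define v where "v = map (\<lambda>i. \<lfloor>real (Suc n) * x (h k i)\<rfloor>) [0..<N k]"
      have "described x k n v"
        unfolding described_def v_def using x mod by blast
      from close[OF this pick[OF this]] n have "sup_dist x (pick (k, n, v)) < e" by linarith
      then show ?thesis by (intro exI[of _ "to_nat (k, n, v)"]) simp
    qed
  qed
qed

lemma C_paths_complete:
  fixes z :: "nat \<Rightarrow> ('d::finite) path"
  assumes z: "\<And>n. z n \<in> C_paths" and cauchy: "Metric_space.MCauchy D_paths sup_dist z"
  shows "\<exists>x\<in>C_paths. limitin (Metric_space.mtopology D_paths sup_dist) z x sequentially"
proof -
  interpret D: Metric_space "D_paths :: 'd path set" sup_dist by (rule Metric_space_D_paths)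
  have zD: "z n \<in> D_paths" for n using z C_paths_subset_D_paths by blast
  have "uniformly_Cauchy_on cube z"
    unfolding uniformly_Cauchy_on_def
  proof (intro allI impI)
    fix e :: real assume "0 < e"
    then obtain N where N: "\<And>m n. N \<le> m \<Longrightarrow> N \<le> n \<Longrightarrow> sup_dist (z m) (z n) < e"
      using cauchy unfolding D.MCauchy_def by meson
    have "dist (z m t) (z n t) < e" if "t \<in> cube" "N \<le> m" "N \<le> n" for t m n
      using N[OF that(2,3)] sup_dist_le_iff[OF zD zD, of m n "sup_dist (z m) (z n)"] that(1)
      by (force simp: dist_real_def)
    then show "\<exists>M. \<forall>x\<in>cube. \<forall>m\<ge>M. \<forall>n\<ge>M. dist (z m x) (z n x) < e" by blast
  qed
  then have "uniformly_convergent_on cube z"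
    by (rule Cauchy_uniformly_convergent)
  then obtain l where l: "uniform_limit cube z l sequentially"
    by (auto simp: uniformly_convergent_on_def)
  have cont: "continuous_on cube l"
    by (rule uniform_limit_theorem[OF _ l]) (use z in \<open>auto simp: C_paths_def\<close>)
  define x where "x = restrict l cube"
  have x: "x \<in> C_paths"
    using continuous_on_eq[OF cont, of x] by (auto simp: C_paths_def x_def)
  then have xD: "x \<in> D_paths" using C_paths_subset_D_paths by blast
  have "limitin D.mtopology z x sequentially"
    unfolding D.limitin_metric
  proof (intro conjI allI impI xD)
    fix e :: real assume e: "0 < e"
    have "\<forall>\<^sub>F n in sequentially. \<forall>t\<in>cube. dist (z n t) (l t) < e / 2"
      by (rule uniform_limitD[OF l]) (use e in simp)
    then show "\<forall>\<^sub>F n in sequentially. z n \<in> D_paths \<and> sup_dist (z n) x < e"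
    proof eventually_elim
      case (elim n)
      then have "sup_dist (z n) x \<le> e / 2"
        unfolding sup_dist_le_iff[OF zD xD] by (auto simp: x_def dist_real_def less_imp_le)
      with e zD show ?case by auto
    qed
  qed
  with x show ?thesis by blast
qed

lemma C_paths_core:
  obtains y :: "nat \<Rightarrow> ('d::finite) path"
  where "measured_separable_core D_paths sup_dist C_paths y (path_space D_paths)"
proof -
  obtain y :: "nat \<Rightarrow> 'd path"
    where y: "\<And>i. y i \<in> C_paths" "\<And>x e. x \<in> C_paths \<Longrightarrow> 0 < e \<Longrightarrow> \<exists>i. sup_dist x (y i) < e"
    using C_paths_separable by metis
  interpret D: Metric_space "D_paths :: 'd path set" sup_dist by (rule Metric_space_D_paths)
  have "measured_separable_core D_paths sup_dist C_paths y (path_space D_paths)"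
  proof
    show "(\<lambda>x. sup_dist x (y i)) \<in> borel_measurable (path_space D_paths)" for i
    proof (rule measurable_sup_dist)
      show "(\<lambda>x. x) \<in> path_space D_paths \<rightarrow>\<^sub>M path_space (D_paths :: 'd path set)"
        by (rule measurable_ident_sets) simp
      show "(\<lambda>x. y i) \<in> path_space D_paths \<rightarrow>\<^sub>M path_space D_paths"
        using y(1) C_paths_subset_D_paths by (intro measurable_const) (auto simp: space_path_space D_paths_extensional)
    qed
    show "\<exists>x\<in>C_paths. limitin D.mtopology z x sequentially"
      if "\<And>n. z n \<in> C_paths" "D.MCauchy z" for z
      using that by (rule C_paths_complete)
  qed (use y C_paths_subset_D_paths in \<open>auto simp: space_path_space D_paths_extensional\<close>)
  then show thesis by (rule that)
qed

lemma continuous_map_paths_iff: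
  fixes f :: "('d::finite) path \<Rightarrow> real"
  assumes "S \<subseteq> D_paths"
  shows "continuous_map (Metric_space.mtopology S sup_dist) euclideanreal f \<longleftrightarrow>
    (\<forall>x\<in>S. \<forall>e>0. \<exists>r>0. \<forall>z\<in>S. sup_dist x z < r \<longrightarrow> \<bar>f z - f x\<bar> < e)"
proof -
  interpret S: Metric_space S sup_dist
    using Metric_space.subspace[OF Metric_space_D_paths assms] .
  show ?thesis
    using S.metric_continuous_map[OF Met_TC.Metric_space_axioms, of f]
    by (simp add: dist_real_def abs_minus_commute Ball_def imp_conjL)
qed

lemma sup_dist_integral_le:
  fixes X X' :: "'w \<Rightarrow> ('d::finite) path"
  assumes X: "X \<in> P \<rightarrow>\<^sub>M path_space D_paths" and X': "X' \<in> P \<rightarrow>\<^sub>M path_space D_paths"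
    and le: "(\<integral>\<^sup>+w. sup_norm (\<lambda>t. X w t - X' w t) \<partial>P) \<le> ennreal c" and c: "0 \<le> c"
  shows "integrable P (\<lambda>w. sup_dist (X w) (X' w))" "(\<integral>w. sup_dist (X w) (X' w) \<partial>P) \<le> c"
proof -
  have eq: "ennreal (sup_dist (X w) (X' w)) = sup_norm (\<lambda>t. X w t - X' w t)" if "w \<in> space P" for w
  proof -
    have "sup_norm (\<lambda>t. X w t - X' w t) < \<top>"
      unfolding sup_norm_less_top_iff
      by (intro bounded_image_diff D_paths_bounded measurable_path_spaceD(1)[OF _ D_paths_extensional that] X X')
    then show ?thesis by (simp add: sup_dist_def)
  qed
  have nonneg: "0 \<le> sup_dist (X w) (X' w)" for w by (simp add: sup_dist_def)
  have le': "(\<integral>\<^sup>+w. ennreal (sup_dist (X w) (X' w)) \<partial>P) \<le> ennreal c"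
    using le by (simp add: eq cong: nn_integral_cong)
  show int: "integrable P (\<lambda>w. sup_dist (X w) (X' w))"
    using measurable_sup_dist[OF X X'] le_less_trans[OF le' ennreal_less_top] nonneg
    by (intro integrableI_nonneg) auto
  have "ennreal (\<integral>w. sup_dist (X w) (X' w) \<partial>P) \<le> ennreal c"
    using le' by (simp add: nn_integral_eq_integral[OF int] nonneg)
  then show "(\<integral>w. sup_dist (X w) (X' w) \<partial>P) \<le> c"
    using c by simp
qed

section \<open>The remainder of the series\<close>

lemma nn_integral_count_space_mono_set:
  assumes "A \<subseteq> B"
  shows "(\<integral>\<^sup>+j. f j \<partial>count_space A) \<le> (\<integral>\<^sup>+j. f j \<partial>count_space B)"
proof -
  have "(\<integral>\<^sup>+j. f j * indicator A j \<partial>count_space UNIV) \<le> (\<integral>\<^sup>+j. f j * indicator B j \<partial>count_space UNIV)"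
    using assms by (intro nn_integral_mono) (auto simp: indicator_def)
  then show ?thesis by (simp add: nn_integral_count_space_indicator)
qed

lemma abs_has_sum_le_nn_integral:
  fixes f :: "'i \<Rightarrow> real"
  assumes "(f has_sum s) J"
  shows "ennreal \<bar>s\<bar> \<le> (\<integral>\<^sup>+j. ennreal \<bar>f j\<bar> \<partial>count_space J)"
proof (rule tendsto_upperbound)
  show "((\<lambda>F. ennreal \<bar>sum f F\<bar>) \<longlongrightarrow> ennreal \<bar>s\<bar>) (finite_subsets_at_top J)"
    using assms unfolding has_sum_def by (intro tendsto_ennrealI tendsto_rabs)
  show "\<forall>\<^sub>F F in finite_subsets_at_top J. ennreal \<bar>sum f F\<bar> \<le> (\<integral>\<^sup>+j. ennreal \<bar>f j\<bar> \<partial>count_space J)"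
  proof (rule eventually_finite_subsets_at_top_weakI)
    fix F assume F: "finite F" "F \<subseteq> J"
    have "ennreal \<bar>sum f F\<bar> \<le> ennreal (\<Sum>j\<in>F. \<bar>f j\<bar>)"
      by (intro ennreal_leI sum_abs)
    also have "\<dots> = (\<integral>\<^sup>+j. ennreal \<bar>f j\<bar> \<partial>count_space F)"
      using F by (simp add: nn_integral_count_space_finite)
    also have "\<dots> \<le> (\<integral>\<^sup>+j. ennreal \<bar>f j\<bar> \<partial>count_space J)"
      by (rule nn_integral_count_space_mono_set[OF F(2)])
    finally show "ennreal \<bar>sum f F\<bar> \<le> (\<integral>\<^sup>+j. ennreal \<bar>f j\<bar> \<partial>count_space J)" .
  qed
qed simp

lemma absolute_tails:
  fixes a :: "'i \<Rightarrow> real"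
  assumes a: "(\<lambda>j. \<bar>a j\<bar>) summable_on I" and J: "incseq J" "(\<Union>m. J m) = I"
  shows absolute_tail_finite: "(\<integral>\<^sup>+j. ennreal \<bar>a j\<bar> \<partial>count_space (I - J m)) < \<infinity>"
    and absolute_tail_tendsto_0: "(\<lambda>m. \<integral>\<^sup>+j. ennreal \<bar>a j\<bar> \<partial>count_space (I - J m)) \<longlonglongrightarrow> 0"
proof -
  have "integrable (count_space I) a"
    using a abs_summable_equivalent[of a I] by (simp add: Infinite_Set_Sum.abs_summable_on_def)
  then have fin: "(\<integral>\<^sup>+j. ennreal \<bar>a j\<bar> \<partial>count_space I) < \<infinity>"
    by (simp add: integrable_iff_bounded)
  show "(\<integral>\<^sup>+j. ennreal \<bar>a j\<bar> \<partial>count_space (I - J m)) < \<infinity>"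
    by (rule le_less_trans[OF nn_integral_count_space_mono_set fin]) auto
  have "(\<lambda>m. \<integral>\<^sup>+j. ennreal \<bar>a j\<bar> * indicator (- J m) j \<partial>count_space I)
      \<longlonglongrightarrow> (\<integral>\<^sup>+j. 0 \<partial>count_space I)"
  proof (rule nn_integral_dominated_convergence[OF _ _ _ _ fin])
    show "AE j in count_space I. (\<lambda>m. ennreal \<bar>a j\<bar> * indicator (- J m) j) \<longlonglongrightarrow> 0"
      unfolding AE_count_space
    proof
      fix j assume "j \<in> I"
      then obtain m0 where "j \<in> J m0" using J(2) by blast
      then have "j \<in> J m" if "m0 \<le> m" for m using incseqD[OF J(1) that] by blast
      then have "\<forall>\<^sub>F m in sequentially. ennreal \<bar>a j\<bar> * indicator (- J m) j = 0"
        unfolding eventually_sequentially by (intro exI[of _ m0]) simp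
      then show "(\<lambda>m. ennreal \<bar>a j\<bar> * indicator (- J m) j) \<longlonglongrightarrow> 0"
        by (rule tendsto_eventually)
    qed
  qed (auto simp: indicator_def)
  moreover have "(\<integral>\<^sup>+j. ennreal \<bar>a j\<bar> * indicator (- J m) j \<partial>count_space I)
      = (\<integral>\<^sup>+j. ennreal \<bar>a j\<bar> \<partial>count_space (I - J m))" for m
    by (simp add: nn_integral_count_space_indicator)
       (auto intro!: nn_integral_cong simp: indicator_def)
  ultimately show "(\<lambda>m. \<integral>\<^sup>+j. ennreal \<bar>a j\<bar> \<partial>count_space (I - J m)) \<longlonglongrightarrow> 0"
    by simp
qed

text \<open>The difference of the two sums is the series over \<open>J2 - J1\<close>, which the triangle inequality
  bounds at every point of the cube; the expectation of the bound is computed by Tonelli's theorem.\<close>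
lemma expected_sup_norm_of_remainder:
  fixes U :: "'i \<Rightarrow> 'w \<Rightarrow> ('d::finite) path"
  assumes I: "countable I" and U: "\<And>j. j \<in> I \<Longrightarrow> U j \<in> P \<rightarrow>\<^sub>M path_space D_paths"
    and K: "\<And>j. j \<in> I \<Longrightarrow> (\<integral>\<^sup>+w. sup_norm (U j w) \<partial>P) \<le> K"
    and X: "represents P J1 a U X" and X': "represents P J2 a U X'" and J: "J1 \<subseteq> J2" "J2 \<subseteq> I"
  shows "(\<integral>\<^sup>+w. sup_norm (\<lambda>t. X' w t - X w t) \<partial>P)
    \<le> K * (\<integral>\<^sup>+j. ennreal \<bar>a j\<bar> \<partial>count_space (I - J1))"
proof -
  have pointwise: "AE w in P. sup_norm (\<lambda>t. X' w t - X w t)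
      \<le> (\<integral>\<^sup>+j. ennreal \<bar>a j\<bar> * sup_norm (U j w) \<partial>count_space (I - J1))"
    using X X' unfolding represents_def
  proof eventually_elim
    case (elim w)
    show ?case
      unfolding sup_norm_def[of "\<lambda>t. X' w t - X w t"]
    proof (rule SUP_least)
      fix t :: "real^'d" assume t: "t \<in> cube"
      have "((\<lambda>j. a j * U j w t) has_sum (X' w t - X w t)) (J2 - J1)"
        using elim t J(1) by (intro has_sum_Diff) auto
      then have "ennreal \<bar>X' w t - X w t\<bar> \<le> (\<integral>\<^sup>+j. ennreal \<bar>a j * U j w t\<bar> \<partial>count_space (J2 - J1))"
        by (rule abs_has_sum_le_nn_integral)
      also have "\<dots> \<le> (\<integral>\<^sup>+j. ennreal \<bar>a j * U j w t\<bar> \<partial>count_space (I - J1))"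
        using J by (intro nn_integral_count_space_mono_set) auto
      also have "\<dots> \<le> (\<integral>\<^sup>+j. ennreal \<bar>a j\<bar> * sup_norm (U j w) \<partial>count_space (I - J1))"
        unfolding sup_norm_def
        by (intro nn_integral_mono) (auto simp: abs_mult ennreal_mult intro!: mult_left_mono SUP_upper t)
      finally show "ennreal \<bar>X' w t - X w t\<bar>
          \<le> (\<integral>\<^sup>+j. ennreal \<bar>a j\<bar> * sup_norm (U j w) \<partial>count_space (I - J1))" .
    qed
  qed
  have meas: "(\<lambda>w. sup_norm (U j w)) \<in> borel_measurable P" if "j \<in> I" for j
    by (rule measurable_sup_norm[OF U[OF that]])
  have "(\<integral>\<^sup>+w. sup_norm (\<lambda>t. X' w t - X w t) \<partial>P)
      \<le> (\<integral>\<^sup>+w. \<integral>\<^sup>+j. ennreal \<bar>a j\<bar> * sup_norm (U j w) \<partial>count_space (I - J1) \<partial>P)"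
    by (rule nn_integral_mono_AE[OF pointwise])
  also have "\<dots> = (\<integral>\<^sup>+j. \<integral>\<^sup>+w. ennreal \<bar>a j\<bar> * sup_norm (U j w) \<partial>P \<partial>count_space (I - J1))"
    using I meas by (intro nn_integral_count_space_nn_integral) auto
  also have "\<dots> = (\<integral>\<^sup>+j. ennreal \<bar>a j\<bar> * (\<integral>\<^sup>+w. sup_norm (U j w) \<partial>P) \<partial>count_space (I - J1))"
    using meas by (intro nn_integral_cong nn_integral_cmult) auto
  also have "\<dots> \<le> (\<integral>\<^sup>+j. ennreal \<bar>a j\<bar> * K \<partial>count_space (I - J1))"
    using K by (intro nn_integral_mono mult_left_mono) auto
  also have "\<dots> = K * (\<integral>\<^sup>+j. ennreal \<bar>a j\<bar> \<partial>count_space (I - J1))"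
    by (subst nn_integral_multc) (auto simp: mult.commute)
  finally show ?thesis .
qed

section \<open>Weak convergence of the series\<close>

text \<open>If \<open>S\<close> is \<open>C_paths\<close>, the processes are treated as processes with cadlag paths,
  so that both cases share the same test functions. The limit process found by
  \<open>cauchy_laws_converge\<close> is replaced by the identity on the space of continuous paths with the law
  of that process.\<close>
theorem lemma2:
  fixes I :: "'i set"
    and a :: "'i \<Rightarrow> real"
    and P :: "nat \<Rightarrow> 'w measure"
    and U :: "nat \<Rightarrow> 'i \<Rightarrow> 'w \<Rightarrow> ('d::finite) path"
    and \<psi> :: "nat \<Rightarrow> 'w \<Rightarrow> 'd path"
    and J :: "nat \<Rightarrow> 'i set"
    and V :: "nat \<Rightarrow> nat \<Rightarrow> 'w \<Rightarrow> 'd path"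
    and Q :: "nat \<Rightarrow> 'v measure"
    and Z :: "nat \<Rightarrow> 'v \<Rightarrow> 'd path"
    and S :: "'d path set"
  assumes S: "S = C_paths \<or> S = D_paths"
    and I: "countable I"
    and a: "(\<lambda>j. \<bar>a j\<bar>) summable_on I"
    and P: "\<And>n. prob_space (P n)"
    and U: "\<And>n j. j \<in> I \<Longrightarrow> U n j \<in> P n \<rightarrow>\<^sub>M path_space S"
    and U_bound: "(SUP n. SUP j\<in>I. \<integral>\<^sup>+ \<omega>. sup_norm (U n j \<omega>) \<partial>P n) < \<infinity>"
    and \<psi>: "\<And>n. \<psi> n \<in> P n \<rightarrow>\<^sub>M path_space S"
    and \<psi>_rep: "\<And>n. represents (P n) I a (U n) (\<psi> n)"
    and J: "incseq J" "(\<Union>m. J m) = I"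
    and V: "\<And>m n. V m n \<in> P n \<rightarrow>\<^sub>M path_space S"
    and V_rep: "\<And>m n. represents (P n) (J m) a (U n) (V m n)"
    and Q: "\<And>m. prob_space (Q m)"
    and Z: "\<And>m. Z m \<in> Q m \<rightarrow>\<^sub>M path_space C_paths"
    and V_conv: "\<And>m. weakly_converges S P (V m) (Q m) (Z m)"
  shows "\<exists>(R :: 'd path measure) (Y :: 'd path \<Rightarrow> 'd path).
    prob_space R \<and> Y \<in> R \<rightarrow>\<^sub>M path_space C_paths \<and>
    weakly_converges C_paths Q Z R Y \<and> weakly_converges S P \<psi> R Y"
proof -
  obtain y :: "nat \<Rightarrow> 'd path" where
    core: "measured_separable_core D_paths sup_dist C_paths y (path_space D_paths)"
    by (rule C_paths_core)
  interpret measured_separable_core D_paths sup_dist C_paths y "path_space D_paths"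
    by (rule core)
  have CS: "C_paths \<subseteq> S" and SD: "S \<subseteq> D_paths"
    using S C_paths_subset_D_paths by auto
  note to_D = measurable_path_space_subset[OF SD D_paths_extensional]
  note C_to_D = measurable_path_space_subset[OF C_paths_subset_D_paths D_paths_extensional]
  have restrict: "g \<in> borel_measurable (path_space S)" if "g \<in> borel_measurable (path_space D_paths)" for g :: "'d path \<Rightarrow> real"
    by (rule measurable_compose[OF to_D that]) (rule measurable_ident_sets, simp)
  define K where "K = (SUP n. SUP j\<in>I. \<integral>\<^sup>+ \<omega>. sup_norm (U n j \<omega>) \<partial>P n)"
  have K: "(\<integral>\<^sup>+ \<omega>. sup_norm (U n j \<omega>) \<partial>P n) \<le> K" if "j \<in> I" for n j
    unfolding K_def using that by (intro SUP_upper2[of n] SUP_upper2[of j]) auto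
  define \<delta> where "\<delta> m = enn2real (K * (\<integral>\<^sup>+j. ennreal \<bar>a j\<bar> \<partial>count_space (I - J m)))" for m
  have \<delta>_fin: "K * (\<integral>\<^sup>+j. ennreal \<bar>a j\<bar> \<partial>count_space (I - J m)) < \<top>" for m
    using U_bound absolute_tail_finite[OF a J, of m] by (simp add: K_def ennreal_mult_less_top)
  have \<delta>_eq: "ennreal (\<delta> m) = K * (\<integral>\<^sup>+j. ennreal \<bar>a j\<bar> \<partial>count_space (I - J m))" for m
    using \<delta>_fin[of m] by (simp add: \<delta>_def)
  have \<delta>_nonneg: "0 \<le> \<delta> m" for m by (simp add: \<delta>_def)
  have "(\<lambda>m. ennreal (\<delta> m)) \<longlonglongrightarrow> ennreal 0"
    using ennreal_tendsto_cmult[OF _ absolute_tail_tendsto_0[OF a J], of K] U_bound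
    by (simp add: \<delta>_eq K_def)
  then have \<delta>: "\<delta> \<longlonglongrightarrow> 0"
    by (rule tendsto_ennrealD) (auto simp: \<delta>_nonneg)
  have J_I: "J m \<subseteq> I" for m using J(2) by blast
  \<comment> \<open>used for \<open>\<psi> n\<close> and for the later partial sums alike\<close>
  have remainder: "\<bar>(\<integral>\<omega>. g (X \<omega>) \<partial>P n) - (\<integral>\<omega>. g (V m n \<omega>) \<partial>P n)\<bar> \<le> L * \<delta> m"
    if g: "test_fun L g" and X: "X \<in> P n \<rightarrow>\<^sub>M path_space S" and rep: "represents (P n) J' a (U n) X"
      and J': "J m \<subseteq> J'" "J' \<subseteq> I" for L g X n m J'
  proof -
    have "(\<integral>\<^sup>+\<omega>. sup_norm (\<lambda>t. X \<omega> t - V m n \<omega> t) \<partial>P n) \<le> ennreal (\<delta> m)"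
      unfolding \<delta>_eq
      by (rule expected_sup_norm_of_remainder[OF I to_D[OF U] K V_rep rep J'])
    note dist = sup_dist_integral_le[OF to_D[OF X] to_D[OF V] this \<delta>_nonneg]
    show ?thesis
      using test_fun_expectations_close[OF g P to_D[OF X] to_D[OF V] dist(1)]
        mult_left_mono[OF dist(2) test_fun_nonneg[OF g]] by linarith
  qed
  have V_test: "(\<lambda>n. \<integral>\<omega>. g (V m n \<omega>) \<partial>P n) \<longlonglongrightarrow> (\<integral>\<omega>. g (Z m \<omega>) \<partial>Q m)"
    if g: "test_fun L g" for L g m
  proof -
    obtain B where B: "\<And>x. x \<in> D_paths \<Longrightarrow> \<bar>g x\<bar> \<le> B" using g by (rule test_fun_bound) blast
    have "continuous_map (Metric_space.mtopology S sup_dist) euclideanreal g"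
      unfolding continuous_map_paths_iff[OF SD]
    proof (intro ballI allI impI)
      fix x and e :: real assume x: "x \<in> S" and e: "0 < e"
      have "\<bar>g z - g x\<bar> < e" if "z \<in> S" "sup_dist x z < e / (L + 1)" for z
      proof -
        have "\<bar>g z - g x\<bar> \<le> L * sup_dist x z"
          using test_fun_lipschitz[OF g, of x z] x that(1) SD by (simp add: abs_minus_commute subset_iff)
        also have "\<dots> \<le> L * (e / (L + 1))"
          using that(2) test_fun_nonneg[OF g] by (intro mult_left_mono) auto
        also have "\<dots> < e"
          using e test_fun_nonneg[OF g] by (simp add: field_simps)
        finally show ?thesis .
      qed
      then show "\<exists>r>0. \<forall>z\<in>S. sup_dist x z < r \<longrightarrow> \<bar>g z - g x\<bar> < e"
        using e test_fun_nonneg[OF g] by (intro exI[of _ "e / (L + 1)"]) auto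
    qed
    moreover have "bounded (g ` S)"
      unfolding bounded_iff using B SD by (intro exI[of _ B]) auto
    moreover have "g \<in> borel_measurable (path_space S)"
      by (rule restrict[OF test_fun_measurable[OF g]])
    ultimately show ?thesis
      using V_conv[of m] unfolding weakly_converges_def by blast
  qed
  have Z_cauchy: "\<bar>(\<integral>\<omega>. g (Z m \<omega>) \<partial>Q m) - (\<integral>\<omega>. g (Z m' \<omega>) \<partial>Q m')\<bar> \<le> L * \<delta> m"
    if g: "test_fun L g" and m: "m \<le> m'" for L g m m'
  proof (rule LIMSEQ_le_const2)
    show "(\<lambda>n. \<bar>(\<integral>\<omega>. g (V m n \<omega>) \<partial>P n) - (\<integral>\<omega>. g (V m' n \<omega>) \<partial>P n)\<bar>)
        \<longlonglongrightarrow> \<bar>(\<integral>\<omega>. g (Z m \<omega>) \<partial>Q m) - (\<integral>\<omega>. g (Z m' \<omega>) \<partial>Q m')\<bar>"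
      by (intro tendsto_intros V_test[OF g])
    show "\<exists>N. \<forall>n\<ge>N. \<bar>(\<integral>\<omega>. g (V m n \<omega>) \<partial>P n) - (\<integral>\<omega>. g (V m' n \<omega>) \<partial>P n)\<bar> \<le> L * \<delta> m"
      using remainder[OF g V V_rep incseqD[OF J(1) m] J_I] by (simp add: abs_minus_commute)
  qed
  note Z_C = measurable_path_spaceD(1)[OF Z C_paths_extensional]
  obtain R :: "(nat list \<Rightarrow> nat) measure" and e Y
    where R: "prob_space R" and e: "\<And>k. e k \<in> R \<rightarrow>\<^sub>M count_space UNIV"
      and Y_C: "\<And>w. w \<in> space R \<Longrightarrow> Y w \<in> C_paths"
      and Y_near: "\<And>w k. w \<in> space R \<Longrightarrow> sup_dist (y (e k w)) (Y w) \<le> 1 / 2 ^ k"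
      and Y_lim: "\<And>L g. test_fun L g \<Longrightarrow> (\<lambda>m. \<integral>\<omega>. g (Z m \<omega>) \<partial>Q m) \<longlonglongrightarrow> (\<integral>w. g (Y w) \<partial>R)"
    by (rule cauchy_laws_converge[where Q = Q and Z = Z, OF Q C_to_D[OF Z] Z_C \<delta> Z_cauchy])
       (assumption+, rule that)
  have Y: "Y \<in> R \<rightarrow>\<^sub>M path_space C_paths"
    unfolding measurable_path_space_iff[OF C_paths_extensional]
  proof (intro conjI ballI Y_C)
    fix t :: "real^'d" assume t: "t \<in> cube"
    show "(\<lambda>w. Y w t) \<in> borel_measurable R"
    proof (rule borel_measurable_LIMSEQ_real)
      show "(\<lambda>w. y (e k w) t) \<in> borel_measurable R" for k
        by (rule measurable_compose[OF e]) simp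
      fix w assume w: "w \<in> space R"
      have "\<bar>y (e k w) t - Y w t\<bar> \<le> (1 / 2) ^ k" for k
        using sup_dist_le_iff[of "y (e k w)" "Y w" "1 / 2 ^ k"] Y_near[OF w, of k] Y_C[OF w] t
          C_paths_subset_D_paths by (auto simp: power_one_over)
      then have "(\<lambda>k. y (e k w) t - Y w t) \<longlonglongrightarrow> 0"
        by (intro Lim_null_comparison[OF _ LIMSEQ_power_zero[of "1 / 2 :: real"]]) auto
      then show "(\<lambda>k. y (e k w) t) \<longlonglongrightarrow> Y w t"
        by (simp add: LIM_zero_iff)
    qed
  qed
  define R' where "R' = distr R (path_space C_paths) Y"
  have R': "prob_space R'"
    unfolding R'_def by (rule prob_space.prob_space_distr[OF R Y])
  have id: "(\<lambda>x. x) \<in> R' \<rightarrow>\<^sub>M path_space C_paths"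
    unfolding R'_def by (rule measurable_ident_sets) simp
  have R'_C: "x \<in> C_paths" if "x \<in> space R'" for x
    using that by (simp add: R'_def space_path_space C_paths_extensional)
  have Z_test: "(\<lambda>m. \<integral>\<omega>. g (Z m \<omega>) \<partial>Q m) \<longlonglongrightarrow> (\<integral>x. g x \<partial>R')" if g: "test_fun L g" for L g
  proof -
    have "g \<in> borel_measurable (path_space C_paths)"
      by (rule measurable_compose[OF C_to_D test_fun_measurable[OF g]]) (rule measurable_ident_sets, simp)
    then have "(\<integral>x. g x \<partial>R') = (\<integral>w. g (Y w) \<partial>R)"
      unfolding R'_def by (rule integral_distr[OF Y])
    with Y_lim[OF g] show ?thesis by simp
  qed
  have \<psi>_test: "(\<lambda>n. \<integral>\<omega>. g (\<psi> n \<omega>) \<partial>P n) \<longlonglongrightarrow> (\<integral>x. g x \<partial>R')" if g: "test_fun L g" for L g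
  proof (rule LIMSEQ_I)
    fix \<epsilon> :: real assume \<epsilon>: "0 < \<epsilon>"
    have "(\<lambda>m. L * \<delta> m) \<longlonglongrightarrow> 0" by (rule tendsto_mult_right_zero[OF \<delta>])
    then have "\<forall>\<^sub>F m in sequentially. L * \<delta> m < \<epsilon> / 3"
      by (rule order_tendstoD) (use \<epsilon> in simp)
    moreover have "\<forall>\<^sub>F m in sequentially. dist (\<integral>\<omega>. g (Z m \<omega>) \<partial>Q m) (\<integral>x. g x \<partial>R') < \<epsilon> / 3"
      by (rule tendstoD[OF Z_test[OF g]]) (use \<epsilon> in simp)
    ultimately have "\<forall>\<^sub>F m in sequentially. L * \<delta> m < \<epsilon> / 3 \<and>
        dist (\<integral>\<omega>. g (Z m \<omega>) \<partial>Q m) (\<integral>x. g x \<partial>R') < \<epsilon> / 3"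
      by eventually_elim simp
    then obtain m where m: "L * \<delta> m < \<epsilon> / 3" "\<bar>(\<integral>\<omega>. g (Z m \<omega>) \<partial>Q m) - (\<integral>x. g x \<partial>R')\<bar> < \<epsilon> / 3"
      by (auto simp: eventually_sequentially dist_real_def)
    obtain N where N: "\<And>n. N \<le> n \<Longrightarrow>
        \<bar>(\<integral>\<omega>. g (V m n \<omega>) \<partial>P n) - (\<integral>\<omega>. g (Z m \<omega>) \<partial>Q m)\<bar> < \<epsilon> / 3"
      using LIMSEQ_D[OF V_test[OF g, of m], of "\<epsilon> / 3"] \<epsilon> by (auto simp: real_norm_def)
    have "\<bar>(\<integral>\<omega>. g (\<psi> n \<omega>) \<partial>P n) - (\<integral>x. g x \<partial>R')\<bar> < \<epsilon>" if "N \<le> n" for n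
      using N[OF that] m remainder[OF g \<psi> \<psi>_rep J_I order_refl, of n m] by linarith
    then show "\<exists>N. \<forall>n\<ge>N. norm ((\<integral>\<omega>. g (\<psi> n \<omega>) \<partial>P n) - (\<integral>x. g x \<partial>R')) < \<epsilon>"
      by auto
  qed
  \<comment> \<open>used for the \<open>Z m\<close> in the continuous paths and for \<open>\<psi>\<close> in \<open>S\<close>\<close>
  have weak: "weakly_converges T N X R' (\<lambda>x. x)"
    if N: "\<And>n. prob_space (N n)" and X: "\<And>n. X n \<in> N n \<rightarrow>\<^sub>M path_space T"
      and T: "C_paths \<subseteq> T" "T \<subseteq> D_paths"
      and lim: "\<And>L g. test_fun L g \<Longrightarrow> (\<lambda>n. \<integral>\<omega>. g (X n \<omega>) \<partial>N n) \<longlonglongrightarrow> (\<integral>x. g x \<partial>R')"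
    for T :: "'d path set" and N :: "nat \<Rightarrow> 'u measure" and X
    unfolding weakly_converges_def
  proof (intro allI impI)
    fix f :: "'d path \<Rightarrow> real"
    assume f_cont: "continuous_map (Metric_space.mtopology T sup_dist) euclideanreal f"
      and f_bdd: "bounded (f ` T)" and f: "f \<in> borel_measurable (path_space T)"
    obtain B where B: "\<And>x. x \<in> T \<Longrightarrow> \<bar>f x\<bar> \<le> B"
      using f_bdd by (auto simp: bounded_iff)
    have T_ext: "T \<subseteq> extensional cube" using T(2) D_paths_extensional by blast
    note X_D = measurable_path_space_subset[OF T(2) D_paths_extensional X]
    show "(\<lambda>n. \<integral>\<omega>. f (X n \<omega>) \<partial>N n) \<longlonglongrightarrow> (\<integral>x. f x \<partial>R')"
    proof (rule expectations_converge_of_test_funs[OF N X_D R' C_to_D[OF id] lim T])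
      show "\<exists>r>0. \<forall>z\<in>T. sup_dist x z < r \<longrightarrow> \<bar>f z - f x\<bar> < e" if "x \<in> C_paths" "0 < e" for x e
        using f_cont[unfolded continuous_map_paths_iff[OF T(2)]] that T(1) by blast
      show "(\<lambda>x. f x) \<in> borel_measurable R'"
        by (rule measurable_compose[OF measurable_path_space_subset[OF T(1) T_ext id] f])
      show "X n w \<in> T" if "w \<in> space (N n)" for n w
        by (rule measurable_path_spaceD(1)[OF X T_ext that])
      show "(\<lambda>w. f (X n w)) \<in> borel_measurable (N n)" for n
        by (rule measurable_compose[OF X f])
    qed (use B R'_C in auto)
  qed
  show ?thesis
  proof (intro exI conjI)
    show "weakly_converges C_paths Q Z R' (\<lambda>x. x)"
      by (rule weak[OF Q Z order_refl C_paths_subset_D_paths Z_test])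
    show "weakly_converges S P \<psi> R' (\<lambda>x. x)"
      by (rule weak[OF P \<psi> CS SD \<psi>_test])
  qed (rule R' id)+
qed

end
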